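(* Let $n\ge 1$, $A=[I_n,-L_n]:X^{n}\times X\to X^n$, $B=\mathrm{Diag}[\operatorname{div},\dots,\operatorname{div}]:Y^n\to X^n$, and let $$\tilde A=\mathrm{Diag}[\underbrace{a_1I,\dots,a_1I}_{n},a_2I]\ \text{ on } X^n\times X,\qquad a_1\ge 2,\ a_2\ge 2n .$$ Then $\tilde A\ge A^*A$. Consequently, for any $c>0$, the choice $N=acI_n$ (acting on $Y^n$) with $a=8$ and $M=c\tilde A$ satisfies $$N-cB^*B\ge0,\qquad M-cA^*A\ge 0 .$$ Moreover, with this choice of $N$ and $M$, if $\{\rho_k\}$ is a non-decreasing sequence with $\rho_k\in(0,2)$ for all $k$, then for any starting point $(\mathbf q^0,\mathbf p^0,\mathbf u^0)\in Y^n\times(X^n\times X)\times X^n$ the sequence $(\mathbf q^k,\mathbf p^k,\mathbf u^k)$ generated by $$\begin{aligned} \mathbf q^{k+1}&=(N+\partial H)^{-1}\big(B^*(-cA\mathbf p^k+\mathbf u^k)+(N-cB^*B)\mathbf q^k\big),\\ \mathbf p^{k+1}&=(M+\partial G)^{-1}\big(A^*(-c\rho_kB\mathbf q^{k+1}+c(1-\rho_k)A\mathbf p^k+\mathbf u^k)+(M-cA^*A)\mathbf p^k\big),\\ \mathbf u^{k+1}&=\mathbf u^k-c\big(A\mathbf p^{k+1}-(1-\rho_k)A\mathbf p^k+\rho_kB\mathbf q^{k+1}\big) \end{aligned}$$ converges weakly to a saddle-point $(\mathbf q^*,\mathbf p^*,\mathbf u^* )$ of $$\min_{\mathbf u}\max_{\mathbf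 q,\mathbf p}\ L(\mathbf u;\mathbf q,\mathbf p)=-G(\mathbf p)-H(\mathbf q)+\langle\mathbf u,A\mathbf p+B\mathbf q\rangle-\tfrac c2\|A\mathbf p+B\mathbf q\|_2^2 ,$$ and $(\mathbf q^*,\mathbf p^* )$ is a solution of the (discretized) continuous max-flow problem $$\max_{p_s,p_1,\dots,p_n,q_1,\dots,q_n}\ \langle 1,p_s\rangle$$ subject to $|q_i(x)|\le\alpha$, $p_i(x)\le\rho(l_i,x)$ and $(\operatorname{div}q_i-p_s+p_i)(x)=0$ for all $x\in\Omega$ and $i=1,\dots,n$.
   Context: Discrete setting: $\Omega$ is a finite rectangular two-dimensional pixel grid with mesh size $1$; $X=\mathbb{R}^{\Omega}$ and $Y=(\mathbb{R}^2)^{\Omega}$ carry the standard Euclidean inner products (and so do their products). $\nabla:X\to Y$ is the standard forward-difference gradient (with difference set to $0$ at the last row/column in the respective direction, i.e. Neumann boundary conditions), and $\operatorname{div}:=-\nabla^*:Y\to X$. For self-adjoint operators, $S\ge T$ means that $S-T$ is positive semi-definite. $I$ is the identity, $I_n=\mathrm{Diag}[I,\dots,I]$ ($n$ blocks), and $L_n=[I,\dots,I]^T$ ($n$ blocks), so that $L_n:X\to X^n$, $L_np_s=(p_s,\dots,p_s)$. Variables: $\mathbf u=(u_1,\dots,u_n)\in X^n$, $\mathbf q=(q_1,\dots,q_n)\in Y^n$, $\mathbf p=(p_1,\dots,p_n,p_s)\in X^n\times X$; thus $A\mathbf p=(p_1-p_s,\dots,p_n-p_s)$ and $B\mathbf q=(\operatorname{div}q_1,\dots,\operatorname{div}q_n)$.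 Data: $\alpha>0$ and real-valued cost functions $\rho(l_i,\cdot)\in X$, $i=1,\dots,n$ (not to be confused with the relaxation parameters $\rho_k$). $I_{D}$ with a set subscript denotes the indicator function of the set $D$ ($0$ on $D$, $+\infty$ outside). The functions are $$G(\mathbf p)=-\langle p_s,1\rangle+\sum_{i=1}^nI_{\{p_i\le\rho(l_i,x)\}}(p_i),\qquad H(\mathbf q)=\sum_{i=1}^nI_{\{\|q_i\|\le\alpha\}}(q_i),$$ where $p_i\le\rho(l_i,x)$ is meant pointwise in $x\in\Omega$, $\|q_i\|\le\alpha$ means $|q_i(x)|\le\alpha$ for all $x\in\Omega$ with $|\cdot|$ the Euclidean norm on $\mathbb{R}^2$, and $1$ is the constant function. $\partial$ denotes the convex subdifferential. A saddle-point of $L$ is a triple $(\mathbf q^*,\mathbf p^*,\mathbf u^* )$ with $L(\mathbf u^*;\mathbf q,\mathbf p)\le L(\mathbf u^*;\mathbf q^*,\mathbf p^* )\le L(\mathbf u;\mathbf q^*,\mathbf p^* )$ for all $\mathbf u,\mathbf q,\mathbf p$. *)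

theory Defs
  imports "HOL-Analysis.Analysis"
begin

section \<open>Convex analysis\<close>

text \<open>Weak convergence, tested against all continuous linear functionals.\<close>

definition weakly_converges_to ::
    "(nat \<Rightarrow> 'a::real_normed_vector) \<Rightarrow> 'a \<Rightarrow> bool" where
  "weakly_converges_to x l \<longleftrightarrow>
     (\<forall>\<phi> :: 'a \<Rightarrow> real. bounded_linear \<phi> \<longrightarrow> (\<lambda>k. \<phi> (x k)) \<longlonglongrightarrow> \<phi> l)"

definition pos_semidef :: "('a::real_inner \<Rightarrow> 'a) \<Rightarrow> bool" where
  "pos_semidef T \<longleftrightarrow>
     linear T \<and> (\<forall>x y. T x \<bullet> y = x \<bullet> T y) \<and> (\<forall>x. 0 \<le> T x \<bullet> x)"

text \<open>
  For a proper function this set is empty wherever \<open>f\<close> takes the value \<open>\<infinity>\<close>.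
\<close>

definition subdifferential :: "('a::real_inner \<Rightarrow> ereal) \<Rightarrow> 'a \<Rightarrow> 'a set" where
  "subdifferential f x = {v. \<forall>y. f x + ereal (v \<bullet> (y - x)) \<le> f y}"

text \<open>\<open>resolvent N T y\<close> is the set \<open>(N + T)\<^sup>-\<^sup>1(y)\<close> for a set-valued operator \<open>T\<close>.\<close>

definition resolvent :: "('a::real_vector \<Rightarrow> 'a) \<Rightarrow> ('a \<Rightarrow> 'a set) \<Rightarrow> 'a \<Rightarrow> 'a set" where
  "resolvent N T y = {x. \<exists>v \<in> T x. y = N x + v}"

definition cvx_indicator :: "'a set \<Rightarrow> 'a \<Rightarrow> ereal" where
  "cvx_indicator D x = (if x \<in> D then 0 else \<infinity>)"


section \<open>The relaxed preconditioned ADMM\<close>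

text \<open>
  Resolvents are sets, so the implicit steps are inclusions; that they determine a
  unique sequence is not built into the definition.  The state is \<open>(q, p, u)\<close>.
\<close>

definition relaxed_admm_step ::
    "('q::real_inner \<Rightarrow> 'q) \<Rightarrow> ('p::real_inner \<Rightarrow> 'p) \<Rightarrow>
     ('p \<Rightarrow> 'u::real_inner) \<Rightarrow> ('q \<Rightarrow> 'u) \<Rightarrow> ('p \<Rightarrow> ereal) \<Rightarrow> ('q \<Rightarrow> ereal) \<Rightarrow>
     real \<Rightarrow> real \<Rightarrow> 'q \<times> 'p \<times> 'u \<Rightarrow> 'q \<times> 'p \<times> 'u \<Rightarrow> bool" where
  "relaxed_admm_step N M A B G H c r = (\<lambda>(q, p, u) (q', p', u').
     q' \<in> resolvent N (subdifferential H)
            (adjoint B (- (c *\<^sub>R A p) + u) + (N q - c *\<^sub>R adjoint B (B q))) \<and>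
     p' \<in> resolvent M (subdifferential G)
            (adjoint A (- ((c * r) *\<^sub>R B q') + (c * (1 - r)) *\<^sub>R A p + u)
             + (M p - c *\<^sub>R adjoint A (A p))) \<and>
     u' = u - c *\<^sub>R (A p' - (1 - r) *\<^sub>R A p + r *\<^sub>R B q'))"

definition relaxed_admm_seq ::
    "('q::real_inner \<Rightarrow> 'q) \<Rightarrow> ('p::real_inner \<Rightarrow> 'p) \<Rightarrow>
     ('p \<Rightarrow> 'u::real_inner) \<Rightarrow> ('q \<Rightarrow> 'u) \<Rightarrow> ('p \<Rightarrow> ereal) \<Rightarrow> ('q \<Rightarrow> ereal) \<Rightarrow>
     real \<Rightarrow> (nat \<Rightarrow> real) \<Rightarrow> 'q \<times> 'p \<times> 'u \<Rightarrow> (nat \<Rightarrow> 'q \<times> 'p \<times> 'u) \<Rightarrow> bool" where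
  "relaxed_admm_seq N M A B G H c r z0 z \<longleftrightarrow>
     z 0 = z0 \<and> (\<forall>k. relaxed_admm_step N M A B G H c (r k) (z k) (z (Suc k)))"

definition aug_lagrangian ::
    "('p \<Rightarrow> 'u::real_inner) \<Rightarrow> ('q \<Rightarrow> 'u) \<Rightarrow> ('p \<Rightarrow> ereal) \<Rightarrow> ('q \<Rightarrow> ereal) \<Rightarrow>
     real \<Rightarrow> 'u \<Rightarrow> 'q \<Rightarrow> 'p \<Rightarrow> ereal" where
  "aug_lagrangian A B G H c u q p =
     - G p - H q + ereal (u \<bullet> (A p + B q) - c / 2 * (norm (A p + B q))\<^sup>2)"

definition saddle_point :: "('u \<Rightarrow> 'q \<Rightarrow> 'p \<Rightarrow> ereal) \<Rightarrow> 'q \<Rightarrow> 'p \<Rightarrow> 'u \<Rightarrow> bool" where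
  "saddle_point L qs ps us \<longleftrightarrow>
     (\<forall>u q p. L us q p \<le> L us qs ps \<and> L us qs ps \<le> L u qs ps)"


section \<open>The pixel grid and the continuous max-flow model\<close>

text \<open>
  The rectangular grid is the product \<open>'w \<times> 'h\<close> of two finite linearly ordered types,
  which serve as the ranges of the two pixel coordinates.
\<close>

type_synonym ('w, 'h) img = "real ^ ('w \<times> 'h)"
type_synonym ('w, 'h) vfield = "(real ^ 2) ^ ('w \<times> 'h)"

definition next_index :: "'a::{finite,linorder} \<Rightarrow> 'a" where
  "next_index i = Min {j. i < j}"

definition grad ::
    "('w::{finite,linorder}, 'h::{finite,linorder}) img \<Rightarrow> ('w, 'h) vfield" where
  "grad f = (\<chi> x. vector
     [if \<exists>j. fst x < j then f $ (next_index (fst x), snd x) - f $ x else 0,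
      if \<exists>j. snd x < j then f $ (fst x, next_index (snd x)) - f $ x else 0])"

definition divg ::
    "('w::{finite,linorder}, 'h::{finite,linorder}) vfield \<Rightarrow> ('w, 'h) img" where
  "divg q = - adjoint grad q"

definition opL :: "('w::finite, 'h::finite) img \<Rightarrow> (('w, 'h) img ^ 'n)" where
  "opL s = (\<chi> i. s)"

definition opA ::
    "(('w::finite, 'h::finite) img ^ 'n) \<times> ('w, 'h) img \<Rightarrow> (('w, 'h) img ^ 'n)" where
  "opA = (\<lambda>(p, s). p - opL s)"

definition opB ::
    "(('w::{finite,linorder}, 'h::{finite,linorder}) vfield ^ 'n) \<Rightarrow> (('w, 'h) img ^ 'n)" where
  "opB q = (\<chi> i. divg (q $ i))"

definition opAt :: "real \<Rightarrow> real \<Rightarrow> (('w::finite, 'h::finite) img ^ 'n) \<times> ('w, 'h) img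
    \<Rightarrow> (('w, 'h) img ^ 'n) \<times> ('w, 'h) img" where
  "opAt a1 a2 = (\<lambda>(p, s). (a1 *\<^sub>R p, a2 *\<^sub>R s))"

text \<open>In \<open>s \<bullet> 1\<close> the \<open>1\<close> is the constant image.\<close>

definition funG :: "(('w::finite, 'h::finite) img ^ 'n) \<Rightarrow>
    (('w, 'h) img ^ 'n) \<times> ('w, 'h) img \<Rightarrow> ereal" where
  "funG \<rho> = (\<lambda>(p, s). ereal (- (s \<bullet> 1))
     + (\<Sum>i\<in>UNIV. cvx_indicator {v. \<forall>x. v $ x \<le> \<rho> $ i $ x} (p $ i)))"

definition funH :: "real \<Rightarrow> (('w::finite, 'h::finite) vfield ^ 'n) \<Rightarrow> ereal" where
  "funH \<alpha> q = (\<Sum>i\<in>UNIV. cvx_indicator {v. \<forall>x. norm (v $ x) \<le> \<alpha>} (q $ i))"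

definition maxflow_feasible ::
    "real \<Rightarrow> (('w::{finite,linorder}, 'h::{finite,linorder}) img ^ 'n) \<Rightarrow>
     (('w, 'h) vfield ^ 'n) \<Rightarrow> (('w, 'h) img ^ 'n) \<times> ('w, 'h) img \<Rightarrow> bool" where
  "maxflow_feasible \<alpha> \<rho> = (\<lambda>q (p, s). \<forall>i x.
     norm (q $ i $ x) \<le> \<alpha> \<and> p $ i $ x \<le> \<rho> $ i $ x \<and> (divg (q $ i) - s + p $ i) $ x = 0)"

definition maxflow_solution ::
    "real \<Rightarrow> (('w::{finite,linorder}, 'h::{finite,linorder}) img ^ 'n) \<Rightarrow>
     (('w, 'h) vfield ^ 'n) \<Rightarrow> (('w, 'h) img ^ 'n) \<times> ('w, 'h) img \<Rightarrow> bool" where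
  "maxflow_solution \<alpha> \<rho> q p \<longleftrightarrow>
     maxflow_feasible \<alpha> \<rho> q p \<and>
     (\<forall>q' p'. maxflow_feasible \<alpha> \<rho> q' p' \<longrightarrow> 1 \<bullet> snd p' \<le> 1 \<bullet> snd p)"

end

theory Submission
  imports Defs
begin

text \<open>
  With \<open>s = u + c A p\<close> and residual \<open>e = A p + B q'\<close>, where \<open>q'\<close> is the next \<open>q\<close>, the multiplier
  step reads \<open>s' = s - c r e\<close>.  Monotonicity of the subdifferentials makes
  \<open>|s - s*|\<^sup>2 / (c r) + |q - q*|\<^sup>2 + |p - p*|\<^sup>2\<close>, measured in the seminorms of \<open>N - c B\<^sup>* B\<close> and
  \<open>M - c A\<^sup>* A\<close>, non-increasing for every KKT point \<open>(q*, p*, u*)\<close>; here \<open>r\<close> has to be non-decreasing.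

  Since \<open>r\<close> may tend to \<open>2\<close>, this does not force \<open>e\<close> to vanish, only the increments of \<open>p\<close> and \<open>q\<close>
  in the two seminorms.  The first operator is definite, because \<open>|\<nabla>f|\<^sup>2 < 8 |f|\<^sup>2\<close> on a finite grid
  unless \<open>f = 0\<close>; the second one may be degenerate, and the missing direction is recovered from the
  complementarity of \<open>u\<close> and \<open>\<rho> - p\<close>.  So all increments of \<open>p\<close> and \<open>q\<close> vanish, hence also those of
  \<open>e\<close>, and then \<open>e\<close> itself since \<open>s\<close> is bounded.  Cluster points are therefore KKT points, and the
  Lyapunov function at a cluster point tends to \<open>0\<close>.
\<close>

section \<open>The difference operators\<close>

text \<open>Pixels are pairs: without this, quantifiers over pixels are split into their coordinates.\<close>

declare split_paired_All [simp del] split_paired_Ex [simp del]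

lemma next_index_greater:
  fixes i :: "'a::{finite,linorder}"
  assumes "\<exists>j. i < j"
  shows "i < next_index i"
  using Min_in[of "{j. i < j}"] assms by (auto simp: next_index_def)

lemma next_index_least:
  fixes i j :: "'a::{finite,linorder}"
  shows "i < j \<Longrightarrow> next_index i \<le> j"
  unfolding next_index_def by (rule Min_le) auto

lemma inj_on_next_index: "inj_on next_index {i::'a::{finite,linorder}. \<exists>j. i < j}"
proof (rule linorder_inj_onI')
  fix i j :: 'a
  assume "j \<in> {i. \<exists>j. i < j}" "i < j"
  then have "next_index i \<le> j" "j < next_index j"
    using next_index_greater next_index_least by auto
  then show "next_index i \<noteq> next_index j"
    by auto
qed

text \<open>From \<open>(a - b)\<^sup>2 + (a + b)\<^sup>2 = 2 a\<^sup>2 + 2 b\<^sup>2\<close>, as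
  the shifted and the unshifted values each have at most the full square sum. In the equality case
  neighbouring values are negatives of each other and the last value is zero, so every value is
  zero.\<close>

lemma forward_difference_bound:
  fixes f :: "'a::{finite,linorder} \<Rightarrow> real"
  shows "(\<Sum>i | \<exists>j. i < j. (f (next_index i) - f i)\<^sup>2) \<le> 4 * (\<Sum>i\<in>UNIV. (f i)\<^sup>2)"
    and "(\<Sum>i | \<exists>j. i < j. (f (next_index i) - f i)\<^sup>2) = 4 * (\<Sum>i\<in>UNIV. (f i)\<^sup>2) \<Longrightarrow> f i = 0"
proof -
  let ?S = "{i::'a. \<exists>j. i < j}" and ?m = "Max (UNIV::'a set)"
  have m: "?m \<notin> ?S"
    using Max_ge[of "UNIV::'a set"] by (auto simp: not_less)
  have "(\<Sum>i\<in>?S. (f (next_index i))\<^sup>2) = (\<Sum>i\<in>next_index ` ?S. (f i)\<^sup>2)"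
    by (simp add: sum.reindex[OF inj_on_next_index])
  also have "\<dots> \<le> (\<Sum>i\<in>UNIV. (f i)\<^sup>2)"
    by (rule sum_mono2) auto
  finally have shifted: "(\<Sum>i\<in>?S. (f (next_index i))\<^sup>2) \<le> (\<Sum>i\<in>UNIV. (f i)\<^sup>2)" .
  have "(\<Sum>i\<in>insert ?m ?S. (f i)\<^sup>2) \<le> (\<Sum>i\<in>UNIV. (f i)\<^sup>2)"
    by (rule sum_mono2) auto
  with m have unshifted: "(f ?m)\<^sup>2 + (\<Sum>i\<in>?S. (f i)\<^sup>2) \<le> (\<Sum>i\<in>UNIV. (f i)\<^sup>2)"
    by simp
  have "(\<Sum>i\<in>?S. (f (next_index i) - f i)\<^sup>2) + (\<Sum>i\<in>?S. (f (next_index i) + f i)\<^sup>2)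
      = 2 * (\<Sum>i\<in>?S. (f (next_index i))\<^sup>2) + 2 * (\<Sum>i\<in>?S. (f i)\<^sup>2)"
    unfolding sum_distrib_left sum.distrib[symmetric]
    by (rule sum.cong) (auto simp: power2_eq_square algebra_simps)
  \<comment> \<open>The squares of the sums and the last entry, for which \<open>unshifted\<close>
    leaves room, are kept on the left because the equality case rests on them.\<close>
  with shifted unshifted have
    key: "(\<Sum>i\<in>?S. (f (next_index i) - f i)\<^sup>2) + (\<Sum>i\<in>?S. (f (next_index i) + f i)\<^sup>2)
      + 2 * (f ?m)\<^sup>2 \<le> 4 * (\<Sum>i\<in>UNIV. (f i)\<^sup>2)"
    by linarith
  have nn: "0 \<le> (\<Sum>i\<in>?S. (f (next_index i) + f i)\<^sup>2)"
    by (rule sum_nonneg) auto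
  with key show "(\<Sum>i\<in>?S. (f (next_index i) - f i)\<^sup>2) \<le> 4 * (\<Sum>i\<in>UNIV. (f i)\<^sup>2)"
    using zero_le_power2[of "f ?m"] by linarith
  assume "(\<Sum>i\<in>?S. (f (next_index i) - f i)\<^sup>2) = 4 * (\<Sum>i\<in>UNIV. (f i)\<^sup>2)"
  with key nn have zeros: "(f ?m)\<^sup>2 = 0" "(\<Sum>i\<in>?S. (f (next_index i) + f i)\<^sup>2) = 0"
    using zero_le_power2[of "f ?m"] by linarith+
  then have fm: "f ?m = 0" by simp
  have alt: "f (next_index i) + f i = 0" if "i \<in> ?S" for i
    using that zeros(2) by (subst (asm) sum_nonneg_eq_0_iff) auto
  show "f i = 0"
  proof (rule ccontr)
    assume "f i \<noteq> 0"
    \<comment> \<open>The last non-zero entry is not at \<open>?m\<close>, so it has a successor,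
      whose value is zero although it should be \<open>- f k\<close>.\<close>
    define k where "k = Max {i. f i \<noteq> 0}"
    have k: "f k \<noteq> 0" "\<And>j. f j \<noteq> 0 \<Longrightarrow> j \<le> k"
      using Max_in[of "{i. f i \<noteq> 0}"] \<open>f i \<noteq> 0\<close> unfolding k_def by auto
    have "k \<in> ?S"
      using k(1) fm Max_ge[of UNIV k] by (metis UNIV_I finite mem_Collect_eq order_le_less)
    moreover from this have "f (next_index k) = 0"
      using next_index_greater[of k] k(2)[of "next_index k"] by fastforce
    ultimately show False
      using alt[of k] k(1) by simp
  qed
qed

lemma linear_grad: "linear grad"
  by (rule linearI) (auto simp: grad_def vec_eq_iff forall_2 algebra_simps)

text \<open>Each direction is summed with the transverse coordinate outside, so that the inner sums
  are one-dimensional forward differences.\<close>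

lemma norm_grad:
  fixes f :: "('w::{finite,linorder}, 'h::{finite,linorder}) img"
  shows "(norm (grad f))\<^sup>2 =
    (\<Sum>y\<in>UNIV. \<Sum>x | \<exists>j. x < j. (f $ (next_index x, y) - f $ (x, y))\<^sup>2) +
    (\<Sum>x\<in>UNIV. \<Sum>y | \<exists>j. y < j. (f $ (x, next_index y) - f $ (x, y))\<^sup>2)"
proof -
  have "(norm (grad f))\<^sup>2 = (\<Sum>z\<in>UNIV.
      (if \<exists>j. fst z < j then (f $ (next_index (fst z), snd z) - f $ z)\<^sup>2 else 0) +
      (if \<exists>j. snd z < j then (f $ (fst z, next_index (snd z)) - f $ z)\<^sup>2 else 0))"
    unfolding power2_norm_eq_inner inner_vec_def grad_def
    by (rule sum.cong) (auto simp: sum_2 power2_eq_square)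
  also have "\<dots> = (\<Sum>x\<in>UNIV. \<Sum>y\<in>UNIV.
      if \<exists>j. x < j then (f $ (next_index x, y) - f $ (x, y))\<^sup>2 else 0) +
     (\<Sum>x\<in>UNIV. \<Sum>y\<in>UNIV.
      if \<exists>j. y < j then (f $ (x, next_index y) - f $ (x, y))\<^sup>2 else 0)"
    by (simp add: sum.distrib sum.cartesian_product case_prod_unfold cong del: if_weak_cong)
  also have "(\<Sum>x\<in>UNIV. \<Sum>y\<in>UNIV.
      if \<exists>j. x < j then (f $ (next_index x, y) - f $ (x, y))\<^sup>2 else 0) =
      (\<Sum>y\<in>UNIV. \<Sum>x\<in>UNIV.
      if \<exists>j. x < j then (f $ (next_index x, y) - f $ (x, y))\<^sup>2 else 0)"
    by (rule sum.swap)
  finally show ?thesis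
    by (simp add: sum.If_cases Int_def)
qed

text \<open>The constant \<open>8\<close> is \<open>4\<close> for each of the two directions.
  Equality makes both estimates tight, and tightness on every line along the first coordinate
  already forces \<open>f = 0\<close>.\<close>

lemma norm_grad_bound:
  fixes f :: "('w::{finite,linorder}, 'h::{finite,linorder}) img"
  shows "(norm (grad f))\<^sup>2 \<le> 8 * (norm f)\<^sup>2"
    and "(norm (grad f))\<^sup>2 = 8 * (norm f)\<^sup>2 \<Longrightarrow> f = 0"
proof -
  let ?X = "\<lambda>y. \<Sum>x | \<exists>j. x < j. (f $ (next_index x, y) - f $ (x, y))\<^sup>2"
  let ?Y = "\<lambda>x. \<Sum>y | \<exists>j. y < j. (f $ (x, next_index y) - f $ (x, y))\<^sup>2"
  have norm2: "(norm f)\<^sup>2 = (\<Sum>x\<in>UNIV. \<Sum>y\<in>UNIV. (f $ (x, y))\<^sup>2)"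
    unfolding power2_norm_eq_inner inner_vec_def
    by (simp add: sum.cartesian_product case_prod_unfold power2_eq_square)
  have norm2': "(norm f)\<^sup>2 = (\<Sum>y\<in>UNIV. \<Sum>x\<in>UNIV. (f $ (x, y))\<^sup>2)"
    unfolding norm2 by (rule sum.swap)
  have X: "?X y \<le> 4 * (\<Sum>x\<in>UNIV. (f $ (x, y))\<^sup>2)" for y
    by (rule forward_difference_bound(1)[of "\<lambda>x. f $ (x, y)"])
  have Y: "?Y x \<le> 4 * (\<Sum>y\<in>UNIV. (f $ (x, y))\<^sup>2)" for x
    by (rule forward_difference_bound(1)[of "\<lambda>y. f $ (x, y)"])
  have X': "sum ?X UNIV \<le> 4 * (norm f)\<^sup>2"
    unfolding norm2' sum_distrib_left[of 4 _ UNIV] by (rule sum_mono) (rule X[unfolded sum_distrib_left])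
  have Y': "sum ?Y UNIV \<le> 4 * (norm f)\<^sup>2"
    unfolding norm2 sum_distrib_left[of 4 _ UNIV] by (rule sum_mono) (rule Y[unfolded sum_distrib_left])
  show "(norm (grad f))\<^sup>2 \<le> 8 * (norm f)\<^sup>2"
    using X' Y' by (simp add: norm_grad)
  assume "(norm (grad f))\<^sup>2 = 8 * (norm f)\<^sup>2"
  with X' Y' have "sum ?X UNIV = (\<Sum>y\<in>UNIV. 4 * (\<Sum>x\<in>UNIV. (f $ (x, y))\<^sup>2))"
    by (simp add: norm_grad norm2'[symmetric] sum_distrib_left[symmetric])
  then have "?X y = 4 * (\<Sum>x\<in>UNIV. (f $ (x, y))\<^sup>2)" for y
    by (rule sum_mono_inv[where I = UNIV]) (use X in auto)
  then have "f $ (x, y) = 0" for x y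
    by (rule forward_difference_bound(2)[of "\<lambda>x. f $ (x, y)"])
  then show "f = 0"
    by (simp add: vec_eq_iff split_paired_All)
qed

lemma linear_divg: "linear divg"
  unfolding divg_def by (intro linear_compose_neg adjoint_linear linear_grad)

lemma divg_adjoint: "f \<bullet> divg q = - (grad f \<bullet> q)"
  by (simp add: divg_def adjoint_works[OF linear_grad])

text \<open>With \<open>f = divg q\<close>, adjointness and Cauchy-Schwarz give
  \<open>|f|\<^sup>2 \<le> |grad f| |q|\<close>; squaring, inserting the strict gradient bound and
  cancelling \<open>|f|\<^sup>2\<close> finishes. Strictness is what makes the residual operator for
  \<open>q\<close> injective.\<close>

lemma norm_divg_less:
  assumes "q \<noteq> 0"
  shows "(norm (divg q))\<^sup>2 < 8 * (norm q)\<^sup>2"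
proof (cases "divg q = 0")
  case False
  let ?f = "divg q"
  have "(norm (grad ?f))\<^sup>2 < 8 * (norm ?f)\<^sup>2"
    using norm_grad_bound[of ?f] False by fastforce
  moreover have "(norm ?f)\<^sup>2 \<le> norm (grad ?f) * norm q"
    using divg_adjoint[of ?f q] Cauchy_Schwarz_ineq2[of "grad ?f" q]
    by (simp add: power2_norm_eq_inner)
  then have "((norm ?f)\<^sup>2)\<^sup>2 \<le> (norm (grad ?f))\<^sup>2 * (norm q)\<^sup>2"
    unfolding power_mult_distrib[symmetric] by (rule power_mono) simp
  ultimately have "((norm ?f)\<^sup>2)\<^sup>2 < (8 * (norm ?f)\<^sup>2) * (norm q)\<^sup>2"
    using assms by (meson le_less_trans mult_strict_right_mono zero_less_norm_iff zero_less_power)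
  then have "(norm ?f)\<^sup>2 * (norm ?f)\<^sup>2 < (norm ?f)\<^sup>2 * (8 * (norm q)\<^sup>2)"
    by (simp only: power2_eq_square[of "(norm ?f)\<^sup>2"] ac_simps)
  then show ?thesis
    by (rule mult_left_less_imp_less) simp
qed (use assms in simp)

section \<open>Block operators and their residual operators\<close>

lemma linear_opA: "linear opA"
  by (rule linearI) (auto simp: opA_def opL_def vec_eq_iff algebra_simps)

lemma linear_opB: "linear opB"
  by (rule linearI)
    (simp_all add: opB_def vec_eq_iff linear_add[OF linear_divg] linear_scale[OF linear_divg])

lemma adjoint_opA:
  fixes u :: "('w::finite, 'h::finite) img ^ 'n"
  shows "adjoint opA u = (u, - (\<Sum>i\<in>UNIV. u $ i))"
proof -
  have "adjoint opA = (\<lambda>u :: ('w, 'h) img ^ 'n. (u, - (\<Sum>i\<in>UNIV. u $ i)))"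
    by (rule adjoint_unique)
      (auto simp: opA_def opL_def inner_vec_def[where 'b = 'n] inner_diff_left inner_minus_right
        inner_sum_right sum_subtractf)
  then show ?thesis
    by simp
qed

lemma opAt_residual:
  fixes p :: "('w::finite, 'h::finite) img ^ 'n"
  shows "opAt a1 a2 (p, s) - adjoint opA (opA (p, s)) =
    ((a1 - 1) *\<^sub>R p + opL s, (a2 - real CARD('n)) *\<^sub>R s + (\<Sum>i\<in>UNIV. p $ i))"
  unfolding adjoint_opA
  by (auto simp: opAt_def opA_def opL_def vec_eq_iff algebra_simps sum_subtractf
      sum_constant_scaleR simp del: sum_constant)

text \<open>By the parallelogram law \<open>|p - L s|\<^sup>2 = 2 |p|\<^sup>2 + 2 n |s|\<^sup>2 - |p
  + L s|\<^sup>2\<close>. Hence the thresholds \<open>2\<close> and \<open>2 n\<close>; at the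
  thresholds only the square of \<open>p + opL s\<close> remains.\<close>

lemma opAt_residual_inner:
  fixes p :: "('w::finite, 'h::finite) img ^ 'n"
  shows "(opAt a1 a2 (p, s) - adjoint opA (opA (p, s))) \<bullet> (p, s) =
    (norm (p + opL s))\<^sup>2 + (a1 - 2) * (norm p)\<^sup>2 + (a2 - 2 * real CARD('n)) * (norm s)\<^sup>2"
  unfolding opAt_residual power2_norm_eq_inner
  by (simp add: opL_def inner_vec_def[where 'b = 'n] inner_add_left inner_add_right algebra_simps
      inner_sum_left sum.distrib sum_subtractf inner_commute sum_distrib_left inner_sum_right)

lemma linear_opAt: "linear (opAt a1 a2)"
  by (rule linearI) (auto simp: opAt_def algebra_simps)

lemma pos_semidef_diff_adjoint:
  fixes B :: "'a::euclidean_space \<Rightarrow> 'b::euclidean_space"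
  assumes "linear T" "linear B" "\<And>x y. T x \<bullet> y = x \<bullet> T y" "\<And>x. c * (norm (B x))\<^sup>2 \<le> T x \<bullet> x"
  shows "pos_semidef (\<lambda>x. T x - c *\<^sub>R adjoint B (B x))"
  unfolding pos_semidef_def
proof (intro conjI allI)
  show "linear (\<lambda>x. T x - c *\<^sub>R adjoint B (B x))"
    using linear_compose[OF assms(2) adjoint_linear[OF assms(2)]]
    by (intro linear_compose_sub linear_compose_scale_right assms) (simp add: o_def)
  show "(T x - c *\<^sub>R adjoint B (B x)) \<bullet> y = x \<bullet> (T y - c *\<^sub>R adjoint B (B y))" for x y
    by (simp add: assms(3) inner_diff_left inner_diff_right adjoint_works[OF assms(2)]
        adjoint_clauses[OF assms(2)])
  show "0 \<le> (T x - c *\<^sub>R adjoint B (B x)) \<bullet> x" for x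
    using assms(4)[of x]
    by (simp add: inner_diff_left adjoint_clauses[OF assms(2)] power2_norm_eq_inner)
qed

lemma pos_semidef_opAt_residual:
  assumes "a1 \<ge> 2" "a2 \<ge> 2 * real CARD('n)" "c \<ge> 0"
  shows "pos_semidef (\<lambda>p :: (('w::finite, 'h::finite) img ^ 'n) \<times> ('w, 'h) img.
    c *\<^sub>R opAt a1 a2 p - c *\<^sub>R adjoint opA (opA p))"
proof (rule pos_semidef_diff_adjoint[OF linear_compose_scale_right[OF linear_opAt] linear_opA])
  fix p q :: "(('w, 'h) img ^ 'n) \<times> ('w, 'h) img"
  show "c *\<^sub>R opAt a1 a2 p \<bullet> q = p \<bullet> (c *\<^sub>R opAt a1 a2 q)"
    by (cases p; cases q) (simp add: opAt_def algebra_simps)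
  have "0 \<le> (opAt a1 a2 p - adjoint opA (opA p)) \<bullet> p"
    using assms by (cases p) (simp only: opAt_residual_inner, simp)
  then have "(norm (opA p))\<^sup>2 \<le> opAt a1 a2 p \<bullet> p"
    by (simp add: inner_diff_left adjoint_clauses[OF linear_opA] power2_norm_eq_inner)
  then show "c * (norm (opA p))\<^sup>2 \<le> c *\<^sub>R opAt a1 a2 p \<bullet> p"
    using assms by (simp add: mult_left_mono)
qed

lemma norm_vec_power2: "(norm (q :: 'a::real_inner ^ 'n))\<^sup>2 = (\<Sum>i\<in>UNIV. (norm (q $ i))\<^sup>2)"
  by (simp add: power2_norm_eq_inner inner_vec_def)

text \<open>The divergence bound acts block by block, and one non-zero block makes the sum
  strict.\<close>

lemma norm_opB_less:
  assumes "q \<noteq> 0"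
  shows "(norm (opB q))\<^sup>2 < 8 * (norm q)\<^sup>2"
proof -
  obtain j where j: "q $ j \<noteq> 0"
    using assms by (auto simp: vec_eq_iff)
  have "(norm (divg (q $ i)))\<^sup>2 \<le> 8 * (norm (q $ i))\<^sup>2" for i
    using norm_divg_less[of "q $ i"] by (cases "q $ i = 0") (auto simp: linear_0[OF linear_divg])
  then show ?thesis
    unfolding norm_vec_power2[of q] norm_vec_power2[of "opB q"] sum_distrib_left
    by (intro sum_strict_mono_ex1) (use norm_divg_less[OF j] in \<open>auto simp: opB_def\<close>)
qed

lemma pos_semidef_opB_residual:
  assumes "c \<ge> 0"
  shows "pos_semidef (\<lambda>q. (8 * c) *\<^sub>R q - c *\<^sub>R adjoint opB (opB q))"
proof (rule pos_semidef_diff_adjoint[OF linear_compose_scale_right[OF linear_id[unfolded id_def]]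
      linear_opB])
  fix q :: "('a, 'b) vfield ^ 'c"
  have "(norm (opB q))\<^sup>2 \<le> 8 * (norm q)\<^sup>2"
    using norm_opB_less[of q] by (cases "q = 0") (auto simp: linear_0[OF linear_opB])
  then show "c * (norm (opB q))\<^sup>2 \<le> ((8 * c) *\<^sub>R q) \<bullet> q"
    using mult_left_mono[OF _ assms] by (fastforce simp: power2_norm_eq_inner algebra_simps)
qed simp

lemma inj_opB_residual:
  assumes "c > 0" "(8 * c) *\<^sub>R q - c *\<^sub>R adjoint opB (opB q) = 0"
  shows "q = 0"
proof (rule ccontr)
  assume "q \<noteq> 0"
  have "c * (8 * (q \<bullet> q)) = c * (adjoint opB (opB q) \<bullet> q)"
    using arg_cong[OF assms(2), of "\<lambda>v. v \<bullet> q"] by (simp add: inner_diff_left)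
  then have "8 * (norm q)\<^sup>2 = (norm (opB q))\<^sup>2"
    using assms(1) by (simp add: adjoint_clauses[OF linear_opB] power2_norm_eq_inner)
  with norm_opB_less[OF \<open>q \<noteq> 0\<close>] show False
    by simp
qed

section \<open>Subdifferentials of the cost functions\<close>

text \<open>The subdifferential of an indicator is the normal cone. Nonemptiness of \<open>D\<close>
  supplies a finite value, which rules out subgradients at points outside \<open>D\<close>.\<close>

lemma subdifferential_cvx_indicator:
  assumes "D \<noteq> {}"
  shows "v \<in> subdifferential (cvx_indicator D) x \<longleftrightarrow> x \<in> D \<and> (\<forall>y\<in>D. v \<bullet> (y - x) \<le> 0)"
proof (cases "x \<in> D")
  case True
  then show ?thesis
    by (auto simp: subdifferential_def cvx_indicator_def split: if_splits)
qed (use assms in \<open>auto simp: subdifferential_def cvx_indicator_def\<close>)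

definition dual_ball :: "real \<Rightarrow> (('w::finite, 'h::finite) vfield ^ 'n) set" where
  "dual_ball \<alpha> = {q. \<forall>i x. norm (q $ i $ x) \<le> \<alpha>}"

lemma funH_eq_indicator: "funH \<alpha> = cvx_indicator (dual_ball \<alpha>)"
proof
  fix q :: "('a, 'b) vfield ^ 'c"
  show "funH \<alpha> q = cvx_indicator (dual_ball \<alpha>) q"
  proof (cases "q \<in> dual_ball \<alpha>")
    case True
    then show ?thesis
      by (auto simp: funH_def cvx_indicator_def dual_ball_def)
  next
    case False
    then show ?thesis
      by (auto simp: funH_def cvx_indicator_def dual_ball_def sum_Pinfty)
  qed
qed

lemma funG_eq:
  "funG \<rho> (p, s) = (if \<forall>i x. p $ i $ x \<le> \<rho> $ i $ x then ereal (- (s \<bullet> 1)) else \<infinity>)"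
proof (cases "\<forall>i x. p $ i $ x \<le> \<rho> $ i $ x")
  case False
  then have "(\<Sum>i\<in>UNIV. cvx_indicator {v. \<forall>x. v $ x \<le> \<rho> $ i $ x} (p $ i)) = \<infinity>"
    by (auto simp: cvx_indicator_def sum_Pinfty)
  with False show ?thesis
    by (simp add: funG_def)
qed (simp add: funG_def cvx_indicator_def)

text \<open>\<open>G\<close> is linear in the source flow, which fixes \<open>w\<close>, and an
  indicator of upper bounds in the other flows, whose normal cone is given by signs and
  complementary slackness.\<close>

lemma subdifferential_funG:
  fixes \<rho> p v :: "('w::finite, 'h::finite) img ^ 'n"
  shows "(v, w) \<in> subdifferential (funG \<rho>) (p, s) \<longleftrightarrow> w = -1 \<and>
    (\<forall>i x. p $ i $ x \<le> \<rho> $ i $ x \<and> 0 \<le> v $ i $ x \<and> v $ i $ x * (\<rho> $ i $ x - p $ i $ x) = 0)"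
    (is "?L \<longleftrightarrow> ?R")
proof
  assume ?L
  then have sub: "funG \<rho> (p, s) + ereal (v \<bullet> (p' - p) + w \<bullet> (s' - s)) \<le> funG \<rho> (p', s')" for p' s'
    by (auto simp: subdifferential_def dest: spec[of _ "(p', s')"])
  have feas: "p $ i $ x \<le> \<rho> $ i $ x" for i x
  proof (rule ccontr)
    assume "\<not> p $ i $ x \<le> \<rho> $ i $ x"
    then have "funG \<rho> (p, s) = \<infinity>"
      by (auto simp: funG_eq)
    \<comment> \<open>The point \<open>(\<rho>, 0)\<close> has finite cost, which is incompatible
      with a subgradient at an infeasible point.\<close>
    with sub[of \<rho> 0] show False
      by (simp add: funG_eq)
  qed
  have ineq: "v \<bullet> (p' - p) + (w + 1) \<bullet> (s' - s) \<le> 0" if "\<forall>i x. p' $ i $ x \<le> \<rho> $ i $ x" for p' s'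
    using sub[of p' s'] that feas
    by (auto simp: funG_eq inner_add_left inner_diff_right inner_commute[of 1])
  \<comment> \<open>Moving the source flow by \<open>w + 1\<close> turns the inequality into
    \<open>|w + 1|\<^sup>2 \<le> 0\<close>.\<close>
  have "(w + 1) \<bullet> (w + 1) = 0"
    using ineq[of p "s + (w + 1)"] feas by (intro antisym inner_ge_zero) simp
  then have "w + 1 = 0"
    by (simp only: inner_eq_zero_iff)
  \<comment> \<open>A change of the single entry \<open>(i, x)\<close> by \<open>d\<close>: the
    choice \<open>d = -1\<close> yields the sign, and \<open>d\<close> equal to the slack yields
    complementarity.\<close>
  have ineq_at: "v $ i $ x * d \<le> 0" if "p $ i $ x + d \<le> \<rho> $ i $ x" for i x d
  proof -
    have "\<forall>j y. (p + axis i (axis x d)) $ j $ y \<le> \<rho> $ j $ y"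
      using feas that by (auto simp: axis_def)
    from ineq[OF this, of s] show ?thesis
      by (simp add: inner_axis)
  qed
  have nonneg: "0 \<le> v $ i $ x" for i x
    using ineq_at[of i x "-1"] feas[of i x] by simp
  have "v $ i $ x * (\<rho> $ i $ x - p $ i $ x) = 0" for i x
    using nonneg feas by (intro antisym ineq_at mult_nonneg_nonneg) simp_all
  with nonneg feas \<open>w + 1 = 0\<close> show ?R
    by (simp add: eq_neg_iff_add_eq_0 del: mult_eq_0_iff)
next
  assume R: ?R
  show ?L
    unfolding subdifferential_def mem_Collect_eq
  proof
    fix z :: "(('w, 'h) img ^ 'n) \<times> ('w, 'h) img"
    obtain p' s' where z: "z = (p', s')"
      by fastforce
    show "funG \<rho> (p, s) + ereal ((v, w) \<bullet> (z - (p, s))) \<le> funG \<rho> z"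
    proof (cases "\<forall>i x. p' $ i $ x \<le> \<rho> $ i $ x")
      case True
      have "v $ i $ x * (p' $ i $ x - p $ i $ x) \<le> 0" for i x
      proof -
        have "v $ i $ x * (p' $ i $ x - \<rho> $ i $ x) \<le> 0"
          using R True by (intro mult_nonneg_nonpos) auto
        moreover have "v $ i $ x * (\<rho> $ i $ x - p $ i $ x) = 0"
          using R by blast
        ultimately show ?thesis
          unfolding right_diff_distrib by linarith
      qed
      then have "v \<bullet> (p' - p) \<le> 0"
        by (auto simp: inner_vec_def intro!: sum_nonpos)
      with True R show ?thesis
        by (auto simp: z funG_eq inner_diff_right inner_commute[of 1])
    qed (auto simp: z funG_eq)
  qed
qed

section \<open>Finite values and monotonicity of the subdifferentials\<close>

lemma subdifferential_finite:
  assumes "v \<in> subdifferential f x" "f y \<noteq> \<infinity>" "f x \<noteq> -\<infinity>"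
  shows "\<bar>f x\<bar> \<noteq> \<infinity>"
proof -
  have "f x + ereal (v \<bullet> (y - x)) \<le> f y"
    using assms(1) by (simp add: subdifferential_def)
  with assms(2,3) show ?thesis
    by (cases "f x") auto
qed

text \<open>The two subgradient inequalities are added. The point \<open>z\<close> of finite value
  makes both values real, so that they cancel.\<close>

lemma subdifferential_monotone:
  assumes "v \<in> subdifferential f x" "w \<in> subdifferential f y" "f x \<noteq> -\<infinity>" "f y \<noteq> -\<infinity>" "f z \<noteq> \<infinity>"
  shows "0 \<le> (v - w) \<bullet> (x - y)"
proof -
  obtain a b where "f x = ereal a" "f y = ereal b"
    using subdifferential_finite[OF assms(1,5,3)] subdifferential_finite[OF assms(2,5,4)] by auto
  moreover have "f x + ereal (v \<bullet> (y - x)) \<le> f y" "f y + ereal (w \<bullet> (x - y)) \<le> f x"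
    using assms(1,2) by (auto simp: subdifferential_def)
  ultimately show ?thesis
    by (simp add: inner_diff_left inner_diff_right)
qed

lemma funG_not_MInf: "funG \<rho> p \<noteq> -\<infinity>"
  by (cases p) (simp add: funG_eq)

lemma funG_finite_point: "funG \<rho> (\<rho>, 0) \<noteq> \<infinity>"
  by (simp add: funG_eq)

lemma funH_not_MInf: "funH \<alpha> q \<noteq> -\<infinity>"
  by (simp add: funH_eq_indicator cvx_indicator_def)

lemma zero_in_dual_ball: "\<alpha> \<ge> 0 \<Longrightarrow> 0 \<in> dual_ball \<alpha>"
  by (simp add: dual_ball_def)

lemma funH_finite_point: "\<alpha> \<ge> 0 \<Longrightarrow> funH \<alpha> 0 \<noteq> \<infinity>"
  using zero_in_dual_ball by (simp add: funH_eq_indicator cvx_indicator_def)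

lemma funG_monotone:
  "v \<in> subdifferential (funG \<rho>) p \<Longrightarrow> w \<in> subdifferential (funG \<rho>) p' \<Longrightarrow> 0 \<le> (v - w) \<bullet> (p - p')"
  by (rule subdifferential_monotone[where f = "funG \<rho>" and z = "(\<rho>, 0)"])
    (simp_all add: funG_not_MInf funG_finite_point)

lemma funG_finite: "v \<in> subdifferential (funG \<rho>) p \<Longrightarrow> \<bar>funG \<rho> p\<bar> \<noteq> \<infinity>"
  by (rule subdifferential_finite[where y = "(\<rho>, 0)"]) (simp_all add: funG_not_MInf funG_finite_point)

lemma funH_monotone:
  "\<alpha> \<ge> 0 \<Longrightarrow> v \<in> subdifferential (funH \<alpha>) q \<Longrightarrow> w \<in> subdifferential (funH \<alpha>) q' \<Longrightarrow>
    0 \<le> (v - w) \<bullet> (q - q')"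
  by (rule subdifferential_monotone[where f = "funH \<alpha>" and z = 0])
    (simp_all add: funH_not_MInf funH_finite_point)

lemma funH_finite: "\<alpha> \<ge> 0 \<Longrightarrow> v \<in> subdifferential (funH \<alpha>) q \<Longrightarrow> \<bar>funH \<alpha> q\<bar> \<noteq> \<infinity>"
  by (rule subdifferential_finite[where y = 0]) (simp_all add: funH_not_MInf funH_finite_point)

lemma subdifferential_funH:
  assumes "\<alpha> \<ge> 0"
  shows "v \<in> subdifferential (funH \<alpha>) q \<longleftrightarrow>
    q \<in> dual_ball \<alpha> \<and> (\<forall>q'\<in>dual_ball \<alpha>. v \<bullet> (q' - q) \<le> 0)"
  unfolding funH_eq_indicator
  by (rule subdifferential_cvx_indicator) (use zero_in_dual_ball[OF assms] in blast)

lemma bounded_vec: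
  fixes S :: "('a::real_normed_vector ^ 'n) set"
  assumes "\<And>q i. q \<in> S \<Longrightarrow> norm (q $ i) \<le> C"
  shows "bounded S"
  unfolding bounded_iff
proof (intro exI ballI)
  fix q assume "q \<in> S"
  have "norm q \<le> (\<Sum>i\<in>UNIV. norm (q $ i))"
    unfolding norm_vec_def by (rule L2_set_le_sum) auto
  also have "\<dots> \<le> (\<Sum>i\<in>(UNIV::'n set). C)"
    using assms \<open>q \<in> S\<close> by (intro sum_mono) auto
  finally show "norm q \<le> (\<Sum>i\<in>(UNIV::'n set). C)" .
qed

lemma bounded_vec2:
  fixes S :: "(('a::real_normed_vector ^ 'm) ^ 'n) set"
  assumes "\<And>q i x. q \<in> S \<Longrightarrow> norm (q $ i $ x) \<le> C"
  shows "bounded S"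
proof -
  have "bounded {v :: 'a ^ 'm. \<forall>x. norm (v $ x) \<le> C}"
    by (rule bounded_vec) auto
  then obtain D where "\<And>v :: 'a ^ 'm. (\<And>x. norm (v $ x) \<le> C) \<Longrightarrow> norm v \<le> D"
    unfolding bounded_iff by auto
  then show ?thesis
    using assms by (intro bounded_vec[where C = D]) blast
qed

lemma convex_dual_ball: "convex (dual_ball \<alpha>)"
proof (rule convexI)
  fix p q :: "('a, 'b) vfield ^ 'c" and u v :: real
  assume *: "p \<in> dual_ball \<alpha>" "q \<in> dual_ball \<alpha>" "0 \<le> u" "0 \<le> v" "u + v = 1"
  have "norm (u *\<^sub>R p $ i $ x + v *\<^sub>R q $ i $ x) \<le> \<alpha>" for i x
    using convexD[OF convex_cball, of "p $ i $ x" 0 \<alpha> "q $ i $ x" u v] *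
    by (simp add: dual_ball_def)
  then show "u *\<^sub>R p + v *\<^sub>R q \<in> dual_ball \<alpha>"
    by (simp add: dual_ball_def)
qed

lemma compact_dual_ball: "compact (dual_ball \<alpha>)"
  unfolding compact_eq_bounded_closed
proof
  show "bounded (dual_ball \<alpha> :: (('a, 'b) vfield ^ 'c) set)"
    by (rule bounded_vec2) (auto simp: dual_ball_def)
  show "closed (dual_ball \<alpha> :: (('a, 'b) vfield ^ 'c) set)"
    unfolding dual_ball_def by (intro closed_Collect_all closed_Collect_le continuous_intros)
qed

section \<open>KKT points\<close>

text \<open>Relaxed labelings: a probability vector over the labels at each pixel. Up to
  complementarity this is what \<open>adjoint opA u \<in> subdifferential (funG \<rho>) p\<close>
  demands of \<open>u\<close>.\<close>

definition label_simplex :: "(('w::finite, 'h::finite) img ^ 'n) set" where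
  "label_simplex = {u. \<forall>x. (\<forall>i. 0 \<le> u $ i $ x) \<and> (\<Sum>i\<in>UNIV. u $ i $ x) = 1}"

lemma convex_label_simplex: "convex label_simplex"
  by (rule convexI) (auto simp: label_simplex_def sum.distrib sum_distrib_left[symmetric])

lemma compact_label_simplex: "compact label_simplex"
  unfolding compact_eq_bounded_closed
proof
  show "bounded (label_simplex :: (('a, 'b) img ^ 'c) set)"
  proof (rule bounded_vec2)
    fix u :: "('a, 'b) img ^ 'c" and i x
    assume u: "u \<in> label_simplex"
    then have "u $ i $ x \<le> (\<Sum>j\<in>UNIV. u $ j $ x)"
      by (intro member_le_sum) (auto simp: label_simplex_def)
    with u show "norm (u $ i $ x) \<le> 1"
      by (auto simp: label_simplex_def)
  qed
  show "closed (label_simplex :: (('a, 'b) img ^ 'c) set)"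
    unfolding label_simplex_def
    by (intro closed_Collect_all closed_Collect_conj closed_Collect_le closed_Collect_eq
        continuous_intros)
qed

text \<open>Brouwer's theorem gives a fixed point of the projected step \<open>z - F z\<close>; the
  obtuse-angle property of the projection turns the fixed point equation into the variational
  inequality.\<close>

lemma variational_inequality_solution:
  fixes F :: "'a::euclidean_space \<Rightarrow> 'a"
  assumes "compact K" "convex K" "K \<noteq> {}" "continuous_on K F"
  obtains z where "z \<in> K" "\<And>w. w \<in> K \<Longrightarrow> 0 \<le> F z \<bullet> (w - z)"
proof -
  have cont: "continuous_on K (closest_point K \<circ> (\<lambda>z. z - F z))"
    using assms by (intro continuous_on_compose continuous_intros continuous_on_closest_point)
      (auto intro: compact_imp_closed)
  have self: "closest_point K \<circ> (\<lambda>z. z - F z) \<in> K \<rightarrow> K"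
    using closest_point_in_set[OF compact_imp_closed[OF \<open>compact K\<close>] \<open>K \<noteq> {}\<close>] by auto
  obtain z where "z \<in> K" and z: "closest_point K (z - F z) = z"
    using brouwer[OF assms(1-3) cont self] by (metis comp_apply)
  have "0 \<le> F z \<bullet> (w - z)" if "w \<in> K" for w
    using closest_point_dot[OF \<open>convex K\<close> compact_imp_closed[OF \<open>compact K\<close>] that, of "z - F z"]
    by (simp add: z)
  with that \<open>z \<in> K\<close> show thesis by blast
qed

text \<open>The penalty of the augmented Lagrangian has zero gradient where the residual vanishes,
  so \<open>c\<close> does not occur.\<close>

definition kkt_point :: "real \<Rightarrow> (('w::{finite,linorder}, 'h::{finite,linorder}) img ^ 'n) \<Rightarrow>
    (('w, 'h) vfield ^ 'n) \<Rightarrow> (('w, 'h) img ^ 'n) \<times> ('w, 'h) img \<Rightarrow> (('w, 'h) img ^ 'n) \<Rightarrow> bool" where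
  "kkt_point \<alpha> \<rho> q p u \<longleftrightarrow> opA p + opB q = 0 \<and>
     adjoint opB u \<in> subdifferential (funH \<alpha>) q \<and> adjoint opA u \<in> subdifferential (funG \<rho>) p"

text \<open>
  A KKT point is a saddle point of \<open>\<langle>u, \<rho> + B q\<rangle>\<close> over the label simplex and the dual ball;
  the source flow is the pointwise minimum of \<open>\<rho> + B q\<close> over the labels.
\<close>

lemma kkt_point_exists:
  fixes \<rho> :: "('w::{finite,linorder}, 'h::{finite,linorder}) img ^ 'n"
  assumes "\<alpha> \<ge> 0"
  obtains q p u where "kkt_point \<alpha> \<rho> q p u"
proof -
  define K where "K = (label_simplex :: (('w, 'h) img ^ 'n) set) \<times>
    (dual_ball \<alpha> :: (('w, 'h) vfield ^ 'n) set)"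
  \<comment> \<open>The gradient of \<open>\<langle>u, \<rho> + B q\<rangle>\<close> in
    \<open>u\<close> and its negative gradient in \<open>q\<close>: the variational inequality for
    this field is the saddle condition.\<close>
  define F where "F z = (\<rho> + opB (snd z), - adjoint opB (fst z))"
    for z :: "(('w, 'h) img ^ 'n) \<times> (('w, 'h) vfield ^ 'n)"
  have vertex: "(\<chi> i. \<chi> x. if i = m x then 1 else 0) \<in> label_simplex"
    for m :: "'w \<times> 'h \<Rightarrow> 'n"
    by (auto simp: label_simplex_def)
  have "K \<noteq> {}"
    using vertex zero_in_dual_ball[OF assms] unfolding K_def by fast
  moreover have "continuous_on K F"
    unfolding F_def
    by (intro continuous_intros linear_continuous_on_compose[where f = fst]
        linear_continuous_on_compose[where f = snd] linear_opB adjoint_linear)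
  moreover have "compact K" "convex K"
    unfolding K_def
    by (intro compact_Times convex_Times compact_label_simplex compact_dual_ball
        convex_label_simplex convex_dual_ball)+
  ultimately obtain z where "z \<in> K" and z: "\<And>w. w \<in> K \<Longrightarrow> 0 \<le> F z \<bullet> (w - z)"
    using variational_inequality_solution by metis
  obtain u q where uq: "z = (u, q)" by fastforce
  with \<open>z \<in> K\<close> have u: "u \<in> label_simplex" and q: "q \<in> dual_ball \<alpha>"
    by (auto simp: K_def)
  have VI_u: "0 \<le> (\<rho> + opB q) \<bullet> (v - u)" if "v \<in> label_simplex" for v
    using z[of "(v, q)"] that q by (simp add: K_def F_def uq)
  have VI_q: "adjoint opB u \<bullet> (q' - q) \<le> 0" if "q' \<in> dual_ball \<alpha>" for q'
    using z[of "(u, q')"] that u by (simp add: K_def F_def uq)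
  define g where "g = \<rho> + opB q"
  define m where "m x = arg_min (\<lambda>i. g $ i $ x) (\<lambda>_. True)" for x
  have m: "g $ m x $ x \<le> g $ i $ x" for i x
    using arg_min_least[of UNIV i "\<lambda>i. g $ i $ x"] by (simp add: m_def arg_min_on_def)
  \<comment> \<open>The source flow is the smallest value of \<open>g\<close> over the labels;
    \<open>p\<close> is then forced by conservation, and its slack is \<open>g - s\<close>.\<close>
  define s :: "('w, 'h) img" where "s = (\<chi> x. g $ m x $ x)"
  define p where "p = opL s - opB q"
  have slack: "\<rho> $ i $ x - p $ i $ x = g $ i $ x - s $ x" for i x
    by (simp add: p_def g_def opL_def)
  have slack_nonneg: "s $ x \<le> g $ i $ x" for i x
    using m by (simp add: s_def)
  \<comment> \<open>All weight on a minimising label, so that \<open>g \<bullet> v\<close> is the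
    sum of \<open>s\<close>. Testing the variational inequality with \<open>v\<close> shows that the
    nonnegative complementarity terms have a sum of at most zero.\<close>
  define v where "v = (\<chi> i. \<chi> x. if i = m x then 1 else (0::real))"
  have comp_x: "(\<Sum>i\<in>UNIV. u $ i $ x * (g $ i $ x - s $ x)) = (\<Sum>i\<in>UNIV. g $ i $ x * u $ i $ x) - s $ x" for x
  proof -
    have "(\<Sum>i\<in>UNIV. u $ i $ x * (g $ i $ x - s $ x)) =
      (\<Sum>i\<in>UNIV. g $ i $ x * u $ i $ x) - s $ x * (\<Sum>i\<in>UNIV. u $ i $ x)"
      by (simp add: algebra_simps sum_subtractf sum_distrib_left)
    with u show ?thesis
      by (simp add: label_simplex_def)
  qed
  have "g \<bullet> v = (\<Sum>x\<in>UNIV. \<Sum>i\<in>UNIV. g $ i $ x * v $ i $ x)"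
    unfolding inner_vec_def inner_real_def by (rule sum.swap)
  also have "\<dots> = (\<Sum>x\<in>UNIV. s $ x)"
    by (simp add: v_def s_def if_distrib cong: if_cong)
  finally have "g \<bullet> v = (\<Sum>x\<in>UNIV. s $ x)" .
  moreover have "g \<bullet> u = (\<Sum>x\<in>UNIV. \<Sum>i\<in>UNIV. g $ i $ x * u $ i $ x)"
    unfolding inner_vec_def inner_real_def by (rule sum.swap)
  moreover have "g \<bullet> u \<le> g \<bullet> v"
    using VI_u[of v] vertex[of m] by (simp add: v_def g_def inner_diff_right)
  ultimately have "(\<Sum>x\<in>UNIV. \<Sum>i\<in>UNIV. u $ i $ x * (g $ i $ x - s $ x)) \<le> 0"
    by (simp add: comp_x sum_subtractf)
  moreover have nonneg: "0 \<le> u $ i $ x * (g $ i $ x - s $ x)" for i x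
    using u slack_nonneg by (auto simp: label_simplex_def)
  ultimately have "(\<Sum>x\<in>UNIV. \<Sum>i\<in>UNIV. u $ i $ x * (g $ i $ x - s $ x)) = 0"
    by (intro antisym sum_nonneg)
  then have comp: "u $ i $ x * (g $ i $ x - s $ x) = 0" for i x
    using nonneg by (simp add: sum_nonneg_eq_0_iff sum_nonneg del: mult_eq_0_iff)
  have "adjoint opA u \<in> subdifferential (funG \<rho>) (p, s)"
    unfolding adjoint_opA subdifferential_funG
  proof (intro conjI allI)
    show "- sum (($) u) UNIV = - 1"
      using u by (simp add: label_simplex_def vec_eq_iff)
    show "p $ i $ x \<le> \<rho> $ i $ x" for i x
      using slack[of i x] slack_nonneg[of x i] by simp
    show "0 \<le> u $ i $ x" for i x
      using u by (simp add: label_simplex_def)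
    show "u $ i $ x * (\<rho> $ i $ x - p $ i $ x) = 0" for i x
      using comp slack by simp
  qed
  moreover have "adjoint opB u \<in> subdifferential (funH \<alpha>) q"
    using q VI_q by (simp add: subdifferential_funH[OF assms])
  moreover have "opA (p, s) + opB q = 0"
    by (simp add: opA_def p_def)
  ultimately show thesis
    using that by (auto simp: kkt_point_def)
qed

text \<open>The two subgradient inequalities add up to the first bound, since their linear parts
  combine to \<open>\<langle>us, A p + B q\<rangle>\<close> and the penalty only lowers the value.
  In \<open>u\<close> the value is constant because the residual at \<open>(qs, ps)\<close> is
  zero.\<close>

lemma saddle_point_of_multiplier:
  fixes A :: "'p::euclidean_space \<Rightarrow> 'u::euclidean_space" and B :: "'q::euclidean_space \<Rightarrow> 'u"
  assumes "linear A" "linear B" "c \<ge> 0" and opt: "A ps + B qs = 0"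
    and "adjoint B us \<in> subdifferential H qs" "adjoint A us \<in> subdifferential G ps"
    and "\<bar>H qs\<bar> \<noteq> \<infinity>" "\<bar>G ps\<bar> \<noteq> \<infinity>"
  shows "saddle_point (aug_lagrangian A B G H c) qs ps us"
  unfolding saddle_point_def
proof (intro allI conjI)
  fix u q p
  obtain g h where gh: "G ps = ereal g" "H qs = ereal h"
    using assms(7,8) by auto
  have "H qs + ereal (adjoint B us \<bullet> (q - qs)) \<le> H q" "G ps + ereal (adjoint A us \<bullet> (p - ps)) \<le> G p"
    using assms(5,6) by (auto simp: subdifferential_def)
  moreover have "adjoint B us \<bullet> (q - qs) + adjoint A us \<bullet> (p - ps) = us \<bullet> (A p + B q) - us \<bullet> (A ps + B qs)"
    by (simp add: adjoint_clauses[OF assms(1)] adjoint_clauses[OF assms(2)]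
        linear_diff[OF assms(1)] linear_diff[OF assms(2)] inner_diff_right inner_add_right)
  moreover have "0 \<le> c / 2 * (norm (A p + B q))\<^sup>2"
    using \<open>c \<ge> 0\<close> by simp
  ultimately show "aug_lagrangian A B G H c us q p \<le> aug_lagrangian A B G H c us qs ps"
    by (cases "G p"; cases "H q") (auto simp: aug_lagrangian_def gh opt)
  show "aug_lagrangian A B G H c us qs ps \<le> aug_lagrangian A B G H c u qs ps"
    by (simp add: aug_lagrangian_def opt)
qed

lemma kkt_point_imp_saddle_point:
  assumes "kkt_point \<alpha> \<rho> q p u" "\<alpha> \<ge> 0" "c \<ge> 0"
  shows "saddle_point (aug_lagrangian opA opB (funG \<rho>) (funH \<alpha>) c) q p u"
proof (rule saddle_point_of_multiplier[OF linear_opA linear_opB \<open>c \<ge> 0\<close>])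
  show *: "opA p + opB q = 0" "adjoint opB u \<in> subdifferential (funH \<alpha>) q"
    "adjoint opA u \<in> subdifferential (funG \<rho>) p"
    using assms(1) by (auto simp: kkt_point_def)
  show "\<bar>funH \<alpha> q\<bar> \<noteq> \<infinity>" "\<bar>funG \<rho> p\<bar> \<noteq> \<infinity>"
    using funH_finite[OF \<open>\<alpha> \<ge> 0\<close> *(2)] funG_finite[OF *(3)] .
qed

lemma maxflow_feasible_iff:
  "maxflow_feasible \<alpha> \<rho> q p \<longleftrightarrow>
    q \<in> dual_ball \<alpha> \<and> (\<forall>i x. fst p $ i $ x \<le> \<rho> $ i $ x) \<and> opA p + opB q = 0"
  by (cases p) (auto simp: maxflow_feasible_def dual_ball_def opA_def opB_def opL_def vec_eq_iff
      algebra_simps)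

text \<open>When the two subgradient inequalities against a feasible competitor are added, the
  multiplier terms cancel because both residuals vanish, and only the source flows are left to
  compare.\<close>

lemma kkt_point_imp_maxflow_solution:
  fixes \<rho> :: "('w::{finite,linorder}, 'h::{finite,linorder}) img ^ 'n"
  assumes kkt: "kkt_point \<alpha> \<rho> q p u" and "\<alpha> \<ge> 0"
  shows "maxflow_solution \<alpha> \<rho> q p"
  unfolding maxflow_solution_def
proof (intro conjI allI impI)
  obtain p1 s where p: "p = (p1, s)" by fastforce
  have zero: "opA p + opB q = 0" and subG: "(u, - sum (($) u) UNIV) \<in> subdifferential (funG \<rho>) (p1, s)"
    and q: "q \<in> dual_ball \<alpha>" and ineq: "\<And>q'. q' \<in> dual_ball \<alpha> \<Longrightarrow> adjoint opB u \<bullet> (q' - q) \<le> 0"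
    using kkt by (auto simp: kkt_point_def adjoint_opA subdifferential_funH[OF \<open>\<alpha> \<ge> 0\<close>] p)
  have p1: "\<forall>i x. p1 $ i $ x \<le> \<rho> $ i $ x"
    using subG by (simp add: subdifferential_funG)
  with zero q show "maxflow_feasible \<alpha> \<rho> q p"
    by (simp add: maxflow_feasible_iff p)
  fix q' and p' :: "(('w, 'h) img ^ 'n) \<times> ('w, 'h) img"
  assume "maxflow_feasible \<alpha> \<rho> q' p'"
  then have zero': "opA p' + opB q' = 0" and q': "q' \<in> dual_ball \<alpha>"
    and p': "\<forall>i x. fst p' $ i $ x \<le> \<rho> $ i $ x"
    by (auto simp: maxflow_feasible_iff)
  have "funG \<rho> p + ereal (adjoint opA u \<bullet> (p' - p)) \<le> funG \<rho> p'"
    using subG by (auto simp: subdifferential_def adjoint_opA p)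
  then have "- (s \<bullet> 1) + adjoint opA u \<bullet> (p' - p) \<le> - (snd p' \<bullet> 1)"
    using p' p1 by (cases p') (simp add: funG_eq p)
  moreover have "adjoint opA u \<bullet> (p' - p) + adjoint opB u \<bullet> (q' - q) =
      u \<bullet> (opA p' + opB q') - u \<bullet> (opA p + opB q)"
    by (simp add: adjoint_clauses[OF linear_opA] adjoint_clauses[OF linear_opB]
        linear_diff[OF linear_opA] linear_diff[OF linear_opB] inner_diff_right inner_add_right)
  ultimately show "1 \<bullet> snd p' \<le> 1 \<bullet> snd p"
    using ineq[OF q'] unfolding zero zero' by (simp add: p inner_commute[of 1])
qed

section \<open>The implicit steps\<close>

text \<open>For two distinct solutions, monotonicity and definiteness give contradictory signs to
  \<open>N (x - x') \<bullet> (x - x')\<close>.\<close>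

lemma resolvent_unique:
  fixes N :: "'a::real_inner \<Rightarrow> 'a"
  assumes "linear N" "\<And>v. v \<noteq> 0 \<Longrightarrow> 0 < N v \<bullet> v"
    and mono: "\<And>v w x y. v \<in> T x \<Longrightarrow> w \<in> T y \<Longrightarrow> 0 \<le> (v - w) \<bullet> (x - y)"
    and "x \<in> resolvent N T y" "x' \<in> resolvent N T y"
  shows "x = x'"
proof (rule ccontr)
  assume "x \<noteq> x'"
  have "y - N z \<in> T z" if "z \<in> resolvent N T y" for z
    using that by (auto simp: resolvent_def)
  from mono[OF this[OF assms(4)] this[OF assms(5)]] have "N (x - x') \<bullet> (x - x') \<le> 0"
    by (simp add: linear_diff[OF assms(1)] inner_diff_left inner_diff_right)
  with assms(2)[of "x - x'"] \<open>x \<noteq> x'\<close> show False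
    by simp
qed

text \<open>With a multiple of the identity the step is the projection of \<open>y / a\<close> onto
  the dual ball.\<close>

lemma resolvent_funH:
  fixes y :: "('w::finite, 'h::finite) vfield ^ 'n"
  assumes "\<alpha> \<ge> 0" "a > 0"
  shows "\<exists>!q. q \<in> resolvent (\<lambda>q. a *\<^sub>R q) (subdifferential (funH \<alpha>)) y"
proof (rule ex_ex1I)
  let ?q = "closest_point (dual_ball \<alpha>) (y /\<^sub>R a)"
  have closed: "closed (dual_ball \<alpha> :: (('w, 'h) vfield ^ 'n) set)"
    and ne: "dual_ball \<alpha> \<noteq> ({} :: (('w, 'h) vfield ^ 'n) set)"
    using compact_dual_ball compact_imp_closed zero_in_dual_ball[OF assms(1)] by blast+
  have "(y - a *\<^sub>R ?q) \<bullet> (q' - ?q) \<le> 0" if "q' \<in> dual_ball \<alpha>" for q'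
  proof -
    have "y - a *\<^sub>R ?q = a *\<^sub>R (y /\<^sub>R a - ?q)"
      using \<open>a > 0\<close> by (simp add: scaleR_right_diff_distrib)
    then show ?thesis
      using closest_point_dot[OF convex_dual_ball closed that, of "y /\<^sub>R a"] \<open>a > 0\<close>
      by (simp add: mult_nonneg_nonpos)
  qed
  then have "y - a *\<^sub>R ?q \<in> subdifferential (funH \<alpha>) ?q"
    using closest_point_in_set[OF closed ne] by (simp add: subdifferential_funH[OF assms(1)])
  then show "\<exists>q. q \<in> resolvent (\<lambda>q. a *\<^sub>R q) (subdifferential (funH \<alpha>)) y"
    unfolding resolvent_def by (auto intro!: exI[of _ ?q] bexI[of _ "y - a *\<^sub>R ?q"])
qed (rule resolvent_unique[OF linear_compose_scale_right[OF linear_id[unfolded id_def]]],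
    auto intro: funH_monotone[OF \<open>\<alpha> \<ge> 0\<close>] simp: \<open>a > 0\<close>)

text \<open>As \<open>opAt\<close> is diagonal, the step decouples into scalar problems with
  explicit solutions.\<close>

lemma resolvent_funG:
  fixes y \<rho> :: "('w::finite, 'h::finite) img ^ 'n"
  assumes "c > 0" "a1 > 0" "a2 > 0"
  shows "\<exists>!p. p \<in> resolvent (\<lambda>p. c *\<^sub>R opAt a1 a2 p) (subdifferential (funG \<rho>)) (y, t)"
proof (rule ex_ex1I)
  \<comment> \<open>Entrywise clipping of \<open>y / (c * a1)\<close> at the capacity, and the
    solution of \<open>c * a2 * s - 1 = t\<close>, as the subgradient in the source flow is
    \<open>-1\<close>.\<close>
  let ?p = "\<chi> i. \<chi> x. min (\<rho> $ i $ x) (y $ i $ x / (c * a1))" and ?s = "(1 / (c * a2)) *\<^sub>R (t + 1)"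
  have "(y - (c * a1) *\<^sub>R ?p, -1) \<in> subdifferential (funG \<rho>) (?p, ?s)"
    unfolding subdifferential_funG
    using assms by (auto simp: min_def field_simps)
  then show "\<exists>p. p \<in> resolvent (\<lambda>p. c *\<^sub>R opAt a1 a2 p) (subdifferential (funG \<rho>)) (y, t)"
    unfolding resolvent_def mem_Collect_eq using assms
    by (intro exI[of _ "(?p, ?s)"] bexI[of _ "(y - (c * a1) *\<^sub>R ?p, -1)"]) (auto simp: opAt_def)
next
  have pos: "0 < c *\<^sub>R opAt a1 a2 v \<bullet> v" if "v \<noteq> 0" for v :: "(('w, 'h) img ^ 'n) \<times> ('w, 'h) img"
  proof -
    obtain v1 v2 where v: "v = (v1, v2)" by fastforce
    have "0 < a1 * (v1 \<bullet> v1) + a2 * (v2 \<bullet> v2)"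
    proof (cases "v1 = 0")
      case True
      with that v assms show ?thesis
        by (simp add: zero_prod_def)
    next
      case False
      then show ?thesis
        using assms by (intro add_pos_nonneg) auto
    qed
    moreover have "c *\<^sub>R opAt a1 a2 v \<bullet> v = c * (a1 * (v1 \<bullet> v1) + a2 * (v2 \<bullet> v2))"
      by (simp add: v opAt_def algebra_simps)
    ultimately show ?thesis
      using assms by simp
  qed
  show "p = p'" if "p \<in> resolvent (\<lambda>p. c *\<^sub>R opAt a1 a2 p) (subdifferential (funG \<rho>)) (y, t)"
    "p' \<in> resolvent (\<lambda>p. c *\<^sub>R opAt a1 a2 p) (subdifferential (funG \<rho>)) (y, t)" for p p'
    by (rule resolvent_unique[OF linear_compose_scale_right[OF linear_opAt] pos funG_monotone that])
qed

lemma ex1_sequence: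
  assumes "\<And>k x. \<exists>!y. R k x y"
  shows "\<exists>!z :: nat \<Rightarrow> 'a. z 0 = x0 \<and> (\<forall>k. R k (z k) (z (Suc k)))"
proof (rule ex_ex1I)
  define z where "z = rec_nat x0 (\<lambda>k x. THE y. R k x y)"
  have "z 0 = x0" "\<And>k. R k (z k) (z (Suc k))"
    using theI'[OF assms] by (auto simp: z_def)
  then show "\<exists>z. z 0 = x0 \<and> (\<forall>k. R k (z k) (z (Suc k)))" by blast
next
  fix z z' :: "nat \<Rightarrow> 'a"
  assume "z 0 = x0 \<and> (\<forall>k. R k (z k) (z (Suc k)))" "z' 0 = x0 \<and> (\<forall>k. R k (z' k) (z' (Suc k)))"
  then have "z k = z' k" for k
  proof (induction k)
    case (Suc k)
    with assms[of k "z k"] show ?case by auto metis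
  qed simp
  then show "z = z'" by auto
qed

text \<open>A step is solved in order: \<open>q'\<close> from the old state, \<open>p'\<close> from
  \<open>q'\<close> and the old state, then \<open>u'\<close> explicitly; both resolvents are
  single-valued.\<close>

lemma relaxed_admm_seq_ex1:
  fixes z0 :: "(('w::{finite,linorder}, 'h::{finite,linorder}) vfield ^ 'n) \<times>
    ((('w, 'h) img ^ 'n) \<times> ('w, 'h) img) \<times> (('w, 'h) img ^ 'n)"
  assumes "\<alpha> \<ge> 0" "c > 0" "a1 > 0" "a2 > 0"
  shows "\<exists>!z. relaxed_admm_seq (\<lambda>q. (8 * c) *\<^sub>R q) (\<lambda>p. c *\<^sub>R opAt a1 a2 p) opA opB
    (funG \<rho>) (funH \<alpha>) c r z0 z"
  unfolding relaxed_admm_seq_def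
proof (rule ex1_sequence)
  fix k and x :: "(('w, 'h) vfield ^ 'n) \<times> ((('w, 'h) img ^ 'n) \<times> ('w, 'h) img) \<times> (('w, 'h) img ^ 'n)"
  obtain q p u where x: "x = (q, p, u)" by (cases x) auto
  let ?N = "\<lambda>q. (8 * c) *\<^sub>R q" and ?M = "\<lambda>p. c *\<^sub>R opAt a1 a2 p"
  obtain q' where q': "\<And>v. v \<in> resolvent ?N (subdifferential (funH \<alpha>))
      (adjoint opB (- (c *\<^sub>R opA p) + u) + (?N q - c *\<^sub>R adjoint opB (opB q))) \<longleftrightarrow> v = q'"
    using resolvent_funH[of \<alpha> "8 * c"] assms unfolding Ex1_def by (metis mult_pos_pos zero_less_numeral)
  obtain p' where p': "\<And>v. v \<in> resolvent ?M (subdifferential (funG \<rho>))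
      (adjoint opA (- ((c * r k) *\<^sub>R opB q') + (c * (1 - r k)) *\<^sub>R opA p + u)
             + (?M p - c *\<^sub>R adjoint opA (opA p))) \<longleftrightarrow> v = p'"
    using resolvent_funG[OF assms(2-4), of \<rho>] unfolding Ex1_def by (metis surj_pair)
  have "relaxed_admm_step ?N ?M opA opB (funG \<rho>) (funH \<alpha>) c (r k) x y \<longleftrightarrow>
      y = (q', p', u - c *\<^sub>R (opA p' - (1 - r k) *\<^sub>R opA p + r k *\<^sub>R opB q'))" for y
    by (cases y) (simp only: relaxed_admm_step_def x prod.case q', safe, simp_all only: p')
  then show "\<exists>!y. relaxed_admm_step ?N ?M opA opB (funG \<rho>) (funH \<alpha>) c (r k) x y"
    by simp
qed

section \<open>Vanishing increments\<close>

lemma tendsto_mult_zero_bounded: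
  fixes f g :: "nat \<Rightarrow> real"
  assumes "f \<longlonglongrightarrow> 0" "bounded (range g)"
  shows "(\<lambda>k. f k * g k) \<longlonglongrightarrow> 0"
proof -
  obtain B where "\<And>k. norm (g k) \<le> B"
    using assms(2) by (auto simp: bounded_iff)
  then show ?thesis
    by (intro lim_null_mult_right_bounded[OF assms(1), of _ B]) auto
qed

text \<open>Meant for one pixel: \<open>U i\<close> are multipliers, \<open>R i\<close> slacks, and
  \<open>D\<close> is the increment that all slacks share in the limit. Complementarity before and
  after a step makes the mixed products \<open>U i (Suc k) * R i k\<close> vanish in the limit,
  hence also \<open>U i (Suc k) * D k\<close>, and the multipliers sum to one in the limit.\<close>

lemma complementarity_increment_tendsto_0:
  fixes U R :: "'i::finite \<Rightarrow> nat \<Rightarrow> real" and D :: "nat \<Rightarrow> real"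
  assumes U: "\<And>i k. 0 \<le> U i k" and R: "\<And>i k. 0 \<le> R i k" and UR: "\<And>i k. U i k * R i k = 0"
    and bU: "\<And>i. bounded (range (U i))" and bD: "bounded (range D)"
    and sum1: "(\<lambda>k. \<Sum>i\<in>UNIV. U i k) \<longlonglongrightarrow> 1"
    and inc: "\<And>i. (\<lambda>k. R i (Suc k) - R i k - D k) \<longlonglongrightarrow> 0"
  shows "D \<longlonglongrightarrow> 0"
proof -
  define \<epsilon> where "\<epsilon> i k = R i (Suc k) - R i k - D k" for i k
  have \<epsilon>: "\<epsilon> i \<longlonglongrightarrow> 0" for i
    unfolding \<epsilon>_def by (rule inc)
  have bU': "bounded (range (\<lambda>k. U i (Suc k)))" for i
    by (rule bounded_subset[OF bU[of i]]) auto
  have sum1': "(\<lambda>k. \<Sum>i\<in>UNIV. U i (Suc k)) \<longlonglongrightarrow> 1"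
    using LIMSEQ_Suc[OF sum1] .
  \<comment> \<open>With primes for the next index, each summand is
    \<open>- (U' - U) * (R' - R)\<close> by complementarity. Inserting
    \<open>R' - R = D + \<epsilon>\<close> and summing over \<open>i\<close> leaves products of null
    sequences with bounded ones.\<close>
  define X where "X k = (\<Sum>i\<in>UNIV. U i (Suc k) * R i k + U i k * R i (Suc k))" for k
  have X_eq: "X k = - (((\<Sum>i\<in>UNIV. U i (Suc k)) - (\<Sum>i\<in>UNIV. U i k)) * D k)
      - (\<Sum>i\<in>UNIV. \<epsilon> i k * (U i (Suc k) - U i k))" for k
  proof -
    have "U i (Suc k) * R i k + U i k * R i (Suc k) = U i k * R i k + U i (Suc k) * R i (Suc k)
        - (U i (Suc k) - U i k) * D k - \<epsilon> i k * (U i (Suc k) - U i k)" for i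
      by (simp add: \<epsilon>_def algebra_simps)
    then have "U i (Suc k) * R i k + U i k * R i (Suc k) =
        - ((U i (Suc k) - U i k) * D k) - \<epsilon> i k * (U i (Suc k) - U i k)" for i
      by (simp only: UR)
    then show ?thesis
      by (simp add: X_def sum_subtractf sum_negf left_diff_distrib sum_distrib_right)
  qed
  have "X \<longlonglongrightarrow> - 0 - (\<Sum>i\<in>(UNIV::'i set). 0)"
    unfolding X_eq
    by (intro tendsto_intros tendsto_mult_zero_bounded bounded_minus_comp \<epsilon> bU bU' bD)
      (use tendsto_diff[OF sum1' sum1] in simp)
  then have "X \<longlonglongrightarrow> 0" by simp
  have U'R: "(\<lambda>k. U i (Suc k) * R i k) \<longlonglongrightarrow> 0" for i
  proof (rule real_tendsto_sandwich[OF _ _ tendsto_const \<open>X \<longlonglongrightarrow> 0\<close>])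
    have "U i (Suc k) * R i k \<le> X k" for k
    proof -
      have "U i (Suc k) * R i k \<le> U i (Suc k) * R i k + U i k * R i (Suc k)"
        using U R by simp
      also have "\<dots> \<le> X k"
        unfolding X_def by (rule member_le_sum) (use U R in auto)
      finally show ?thesis .
    qed
    then show "\<forall>\<^sub>F k in sequentially. U i (Suc k) * R i k \<le> X k"
      by simp
  qed (use U R in auto)
  \<comment> \<open>\<open>D = R' - R - \<epsilon>\<close> and \<open>U' * R' = 0\<close> reduce
    this to the mixed product.\<close>
  have "(\<lambda>k. U i (Suc k) * D k) \<longlonglongrightarrow> 0" for i
  proof -
    have "U i (Suc k) * D k = - (U i (Suc k) * R i k) - \<epsilon> i k * U i (Suc k)" for k
    proof -
      have "U i (Suc k) * D k =
          U i (Suc k) * R i (Suc k) - U i (Suc k) * R i k - \<epsilon> i k * U i (Suc k)"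
        by (simp add: \<epsilon>_def algebra_simps)
      then show ?thesis
        by (simp only: UR)
    qed
    moreover have "(\<lambda>k. - (U i (Suc k) * R i k) - \<epsilon> i k * U i (Suc k)) \<longlonglongrightarrow> - 0 - 0"
      by (intro tendsto_intros U'R tendsto_mult_zero_bounded \<epsilon> bU')
    ultimately show ?thesis by simp
  qed
  then have "(\<lambda>k. \<Sum>i\<in>UNIV. U i (Suc k) * D k) \<longlonglongrightarrow> (\<Sum>i\<in>(UNIV::'i set). 0)"
    by (intro tendsto_sum)
  moreover have "(\<lambda>k. (1 - (\<Sum>i\<in>UNIV. U i (Suc k))) * D k) \<longlonglongrightarrow> 0"
    by (rule tendsto_mult_zero_bounded[OF _ bD]) (use tendsto_diff[OF tendsto_const[of 1] sum1'] in simp)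
  ultimately have "(\<lambda>k. (\<Sum>i\<in>UNIV. U i (Suc k) * D k) + (1 - (\<Sum>i\<in>UNIV. U i (Suc k))) * D k) \<longlonglongrightarrow> 0 + 0"
    by (intro tendsto_add) simp_all
  then show ?thesis
    by (simp add: sum_distrib_left[symmetric] sum_distrib_right[symmetric] algebra_simps)
qed

text \<open>
  If the increments vary slowly, \<open>m\<close> consecutive ones are nearly equal, so that
  \<open>m\<close> times an increment is bounded by the diameter of the sequence.
\<close>

lemma increments_tendsto_0:
  fixes x :: "nat \<Rightarrow> 'a::real_normed_vector"
  assumes "bounded (range x)"
    and slow: "(\<lambda>k. (x (Suc (Suc k)) - x (Suc k)) - (x (Suc k) - x k)) \<longlonglongrightarrow> 0"
  shows "(\<lambda>k. x (Suc k) - x k) \<longlonglongrightarrow> 0"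
proof -
  define y where "y k = x (Suc k) - x k" for k
  have y: "(\<lambda>k. y (k + m) - y k) \<longlonglongrightarrow> 0" for m
  proof (induction m)
    case (Suc m)
    have "(\<lambda>k. (y (Suc (k + m)) - y (k + m)) + (y (k + m) - y k)) \<longlonglongrightarrow> 0 + 0"
      using Suc LIMSEQ_ignore_initial_segment[OF slow, of m] by (intro tendsto_add) (auto simp: y_def)
    then show ?case by simp
  qed simp
  have x: "(\<lambda>k. x (k + m) - x k - real m *\<^sub>R y k) \<longlonglongrightarrow> 0" for m
  proof (induction m)
    case (Suc m)
    have "(\<lambda>k. (x (k + m) - x k - real m *\<^sub>R y k) + (y (k + m) - y k)) \<longlonglongrightarrow> 0 + 0"
      using Suc y by (intro tendsto_add)
    then show ?case by (simp add: y_def algebra_simps)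
  qed simp
  obtain C where C: "\<And>k. norm (x k) \<le> C"
    using assms(1) by (auto simp: bounded_iff)
  have "y \<longlonglongrightarrow> 0"
  proof (rule LIMSEQ_I)
    fix \<epsilon> :: real assume "\<epsilon> > 0"
    \<comment> \<open>Twice the bound on \<open>x\<close> has to use less than half of
      \<open>m * \<epsilon>\<close>; the other half absorbs the deviation of
      \<open>x (k + m) - x k\<close> from \<open>m\<close> copies of \<open>y k\<close>.\<close>
    obtain m :: nat where "2 * C / (\<epsilon> / 2) < real m"
      using reals_Archimedean2 by blast
    then have m: "2 * C < real m * (\<epsilon> / 2)"
      using \<open>\<epsilon> > 0\<close> by (simp add: pos_divide_less_eq)
    have "0 \<le> C"
      using C[of 0] norm_ge_zero[of "x 0"] by linarith
    with m \<open>\<epsilon> > 0\<close> have "0 < real m"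
      by (cases m) auto
    then have "0 < real m * (\<epsilon> / 2)"
      using \<open>\<epsilon> > 0\<close> by simp
    from LIMSEQ_D[OF x this] obtain K
      where K: "\<And>k. k \<ge> K \<Longrightarrow> norm (x (k + m) - x k - real m *\<^sub>R y k) < real m * (\<epsilon> / 2)"
      unfolding diff_0_right by blast
    have "norm (y k - 0) < \<epsilon>" if "k \<ge> K" for k
    proof -
      have "real m * norm (y k) = norm ((x (k + m) - x k) - (x (k + m) - x k - real m *\<^sub>R y k))"
        by simp
      also have "\<dots> \<le> norm (x (k + m)) + norm (x k) + norm (x (k + m) - x k - real m *\<^sub>R y k)"
        by (meson norm_triangle_ineq4 order_trans add_right_mono)
      also have "\<dots> < real m * \<epsilon>"
        using C[of "k + m"] C[of k] K[OF that] m by simp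
      finally show ?thesis
        using \<open>0 < real m\<close> by (simp add: mult_less_cancel_left)
    qed
    then show "\<exists>K. \<forall>k\<ge>K. norm (y k - 0) < \<epsilon>" by blast
  qed
  then show ?thesis by (simp add: y_def[abs_def])
qed

text \<open>The quadratic form need not control \<open>x\<close>, but it controls
  \<open>T x\<close>: it is nonnegative at \<open>x - T x / K\<close>, and with
  \<open>norm (T (T x)) \<le> K * norm (T x)\<close> this rearranges to the bound.\<close>

lemma pos_semidef_norm_bound:
  fixes T :: "'a::euclidean_space \<Rightarrow> 'a"
  assumes "pos_semidef T"
  obtains K where "\<And>x. (norm (T x))\<^sup>2 \<le> K * (T x \<bullet> x)"
proof -
  have lin: "linear T" and sym: "\<And>x y. T x \<bullet> y = x \<bullet> T y" and psd: "\<And>x. 0 \<le> T x \<bullet> x"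
    using assms by (auto simp: pos_semidef_def)
  obtain K where "K > 0" and K: "\<And>x. norm (T x) \<le> K * norm x"
    using linear_bounded_pos[OF lin] by blast
  have "(norm (T x))\<^sup>2 \<le> K * (T x \<bullet> x)" for x
  proof -
    have "T (T x) \<bullet> T x \<le> norm (T (T x)) * norm (T x)"
      by (rule norm_cauchy_schwarz)
    also have "\<dots> \<le> K * (norm (T x))\<^sup>2"
      using mult_right_mono[OF K[of "T x"], of "norm (T x)"] by (simp add: power2_eq_square mult.assoc)
    finally have TT: "T (T x) \<bullet> T x \<le> K * (norm (T x))\<^sup>2" .
    have "0 \<le> T (x - (1 / K) *\<^sub>R T x) \<bullet> (x - (1 / K) *\<^sub>R T x)"
      by (rule psd)
    also have "\<dots> = T x \<bullet> x - 2 / K * (norm (T x))\<^sup>2 + (1 / K)\<^sup>2 * (T (T x) \<bullet> T x)"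
      unfolding power2_norm_eq_inner using sym[of "T x" x]
      by (simp add: linear_diff[OF lin] linear_scale[OF lin] inner_diff_left inner_diff_right
          power2_eq_square algebra_simps)
    also have "\<dots> \<le> T x \<bullet> x - 2 / K * (norm (T x))\<^sup>2 + (1 / K)\<^sup>2 * (K * (norm (T x))\<^sup>2)"
      using TT by (intro add_left_mono mult_left_mono) auto
    also have "\<dots> = T x \<bullet> x - (norm (T x))\<^sup>2 / K"
      using \<open>K > 0\<close> by (simp add: power2_eq_square field_simps)
    finally show ?thesis
      using \<open>K > 0\<close> by (simp add: field_simps)
  qed
  then show thesis by (rule that)
qed

lemma pos_semidef_tendsto_0:
  fixes T :: "'a::euclidean_space \<Rightarrow> 'a"
  assumes "pos_semidef T" "(\<lambda>k. T (x k) \<bullet> x k) \<longlonglongrightarrow> 0"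
  shows "(\<lambda>k. T (x k)) \<longlonglongrightarrow> 0"
proof -
  obtain K where K: "\<And>x. (norm (T x))\<^sup>2 \<le> K * (T x \<bullet> x)"
    using pos_semidef_norm_bound[OF assms(1)] by blast
  have "(\<lambda>k. (norm (T (x k)))\<^sup>2) \<longlonglongrightarrow> 0"
    by (rule real_tendsto_sandwich[OF _ _ tendsto_const tendsto_mult_right_zero[OF assms(2), of K]])
      (use K in auto)
  then have "(\<lambda>k. norm (T (x k))) \<longlonglongrightarrow> 0"
    using tendsto_real_sqrt by fastforce
  then show ?thesis
    by (rule tendsto_norm_zero_cancel)
qed

lemma linear_inj_tendsto_0:
  fixes T :: "'a::euclidean_space \<Rightarrow> 'b::euclidean_space"
  assumes "linear T" "\<And>x. T x = 0 \<Longrightarrow> x = 0" "(\<lambda>k. T (x k)) \<longlonglongrightarrow> 0"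
  shows "x \<longlonglongrightarrow> 0"
proof -
  have "inj T"
    using assms(2) by (simp add: linear_injective_0[OF assms(1)])
  then obtain B where "B > 0" and B: "\<And>x. B * norm x \<le> norm (T x)"
    using linear_inj_bounded_below_pos[OF assms(1)] by blast
  show ?thesis
  proof (rule Lim_null_comparison)
    show "\<forall>\<^sub>F k in sequentially. norm (x k) \<le> norm (T (x k)) / B"
      using B \<open>B > 0\<close> by (simp add: pos_le_divide_eq mult.commute)
    show "(\<lambda>k. norm (T (x k)) / B) \<longlonglongrightarrow> 0"
      using tendsto_divide[OF tendsto_norm_zero[OF assms(3)] tendsto_const[of B]] \<open>B > 0\<close> by simp
  qed
qed

section \<open>Descent\<close>

text \<open>The law of cosines in the seminorm of \<open>T\<close>; symmetry lets the mixed terms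
  merge.\<close>

lemma three_point_identity:
  assumes "pos_semidef T"
  shows "2 * (T (x - y) \<bullet> (y - z)) = T (x - z) \<bullet> (x - z) - T (y - z) \<bullet> (y - z) - T (x - y) \<bullet> (x - y)"
proof -
  have lin: "linear T" and sym: "\<And>x y. T x \<bullet> y = x \<bullet> T y"
    using assms by (auto simp: pos_semidef_def)
  show ?thesis
    using sym[of x y] sym[of x z] sym[of y z]
    by (simp add: linear_diff[OF lin] inner_diff_left inner_diff_right inner_commute)
qed

text \<open>The inequality for \<open>p\<close> comes from the step that produced \<open>p\<close>
  and \<open>u\<close>, the one for \<open>q'\<close> from the step after it. Added, their
  multiplier terms collapse to \<open>(\<sigma> - \<sigma>s) \<bullet> E - c |E|\<^sup>2\<close>,
  which the expansion of \<open>|\<sigma>' - \<sigma>s|\<^sup>2\<close> matches up to a term of the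
  right sign.\<close>

lemma relaxed_admm_descent:
  fixes A :: "'p::euclidean_space \<Rightarrow> 'u::euclidean_space" and B :: "'q::euclidean_space \<Rightarrow> 'u"
  assumes "linear A" "linear B" and N: "pos_semidef N" and M: "pos_semidef M"
    and c: "c > 0" and r: "0 < r" "r \<le> 2"
    and opt: "A ps + B qs = 0"
    and hq: "0 \<le> (adjoint B (u - c *\<^sub>R (A p + B q')) + N (q - q') - adjoint B us) \<bullet> (q' - qs)"
    and hp: "0 \<le> (adjoint A u + M (p0 - p) - adjoint A us) \<bullet> (p - ps)"
    and \<sigma>: "\<sigma> = u + c *\<^sub>R A p" "\<sigma>s = us + c *\<^sub>R A ps" "\<sigma>' = \<sigma> - (c * r) *\<^sub>R (A p + B q')"
  shows "(norm (\<sigma>' - \<sigma>s))\<^sup>2 / (c * r) + N (q' - qs) \<bullet> (q' - qs) + M (p - ps) \<bullet> (p - ps)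
      + N (q - q') \<bullet> (q - q') + M (p0 - p) \<bullet> (p0 - p)
    \<le> (norm (\<sigma> - \<sigma>s))\<^sup>2 / (c * r) + N (q - qs) \<bullet> (q - qs) + M (p0 - ps) \<bullet> (p0 - ps)"
proof -
  define E where "E = A p + B q'"
  have E: "B (q' - qs) = E - A (p - ps)"
    using opt by (simp add: E_def linear_diff[OF assms(1)] linear_diff[OF assms(2)] algebra_simps
        eq_neg_iff_add_eq_0[symmetric])
  have "0 \<le> (u - us - c *\<^sub>R E) \<bullet> B (q' - qs) + N (q - q') \<bullet> (q' - qs)"
    using hq by (simp add: E_def[symmetric] inner_add_left inner_diff_left adjoint_clauses[OF assms(2)])
  moreover have "0 \<le> (u - us) \<bullet> A (p - ps) + M (p0 - p) \<bullet> (p - ps)"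
    using hp by (simp add: inner_add_left inner_diff_left adjoint_clauses[OF assms(1)])
  \<comment> \<open>The product of \<open>c E\<close> with \<open>A (p - ps)\<close> is what turns
    \<open>u - us\<close> into \<open>\<sigma> - \<sigma>s\<close>.\<close>
  moreover have "(u - us - c *\<^sub>R E) \<bullet> B (q' - qs) + (u - us) \<bullet> A (p - ps) = (\<sigma> - \<sigma>s) \<bullet> E - c * (norm E)\<^sup>2"
    unfolding E \<sigma>
    by (simp add: power2_norm_eq_inner inner_diff_left inner_diff_right inner_add_left linear_diff[OF assms(1)]
        inner_commute algebra_simps)
  ultimately have key: "0 \<le> (\<sigma> - \<sigma>s) \<bullet> E - c * (norm E)\<^sup>2 + N (q - q') \<bullet> (q' - qs) + M (p0 - p) \<bullet> (p - ps)"
    by linarith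
  have shift: "\<sigma>' - \<sigma>s = (\<sigma> - \<sigma>s) - (c * r) *\<^sub>R E"
    by (simp add: \<sigma>(3) E_def)
  have "(norm (\<sigma>' - \<sigma>s))\<^sup>2 = (norm (\<sigma> - \<sigma>s))\<^sup>2 - 2 * (c * r) * ((\<sigma> - \<sigma>s) \<bullet> E) + (c * r)\<^sup>2 * (norm E)\<^sup>2"
    unfolding shift power2_norm_eq_inner
    by (simp add: inner_diff_left inner_diff_right inner_commute power2_eq_square algebra_simps)
  then have "(norm (\<sigma>' - \<sigma>s))\<^sup>2 / (c * r) = (norm (\<sigma> - \<sigma>s))\<^sup>2 / (c * r)
      - 2 * ((\<sigma> - \<sigma>s) \<bullet> E) + c * r * (norm E)\<^sup>2"
    using c r by (simp add: field_simps power2_eq_square)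
  \<comment> \<open>The relaxation bound: the penalty term \<open>2 c |E|\<^sup>2\<close> pays for
    the quadratic term of the multiplier step.\<close>
  moreover have "c * r * (norm E)\<^sup>2 \<le> 2 * (c * (norm E)\<^sup>2)"
    using c r by (simp add: mult_right_mono)
  ultimately show ?thesis
    using key three_point_identity[OF N, of q q' qs] three_point_identity[OF M, of p0 p ps]
    by linarith
qed

section \<open>Closed graphs of the subdifferentials\<close>

lemma subdifferential_funH_closed:
  assumes "\<alpha> \<ge> 0" "\<And>k. v k \<in> subdifferential (funH \<alpha>) (q k)" "v \<longlonglongrightarrow> v'" "q \<longlonglongrightarrow> q'"
  shows "v' \<in> subdifferential (funH \<alpha>) q'"
  unfolding subdifferential_funH[OF assms(1)]
proof (intro conjI ballI)
  have *: "q k \<in> dual_ball \<alpha>" "\<And>y. y \<in> dual_ball \<alpha> \<Longrightarrow> v k \<bullet> (y - q k) \<le> 0" for k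
    using assms(2)[of k] by (auto simp: subdifferential_funH[OF assms(1)])
  show "q' \<in> dual_ball \<alpha>"
    using closed_sequentially[OF compact_imp_closed[OF compact_dual_ball] _ assms(4)] *(1) by blast
  fix y :: "('a, 'b) vfield ^ 'c"
  assume "y \<in> dual_ball \<alpha>"
  have "(\<lambda>k. v k \<bullet> (y - q k)) \<longlonglongrightarrow> v' \<bullet> (y - q')"
    by (intro tendsto_intros assms)
  then show "v' \<bullet> (y - q') \<le> 0"
    by (rule LIMSEQ_le_const2) (use *(2) \<open>y \<in> dual_ball \<alpha>\<close> in auto)
qed

lemma subdifferential_funG_closed:
  fixes v p :: "nat \<Rightarrow> (('w::finite, 'h::finite) img ^ 'n) \<times> ('w, 'h) img"
  assumes "\<And>k. v k \<in> subdifferential (funG \<rho>) (p k)" "v \<longlonglongrightarrow> v'" "p \<longlonglongrightarrow> p'"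
  shows "v' \<in> subdifferential (funG \<rho>) p'"
proof -
  have *: "snd (v k) = -1" "fst (p k) $ i $ x \<le> \<rho> $ i $ x" "0 \<le> fst (v k) $ i $ x"
    "fst (v k) $ i $ x * (\<rho> $ i $ x - fst (p k) $ i $ x) = 0" for k i x
    using assms(1)[of k] subdifferential_funG[of "fst (v k)" "snd (v k)" \<rho> "fst (p k)" "snd (p k)"]
    by (simp_all del: mult_eq_0_iff)
  have lim_v: "(\<lambda>k. fst (v k) $ i $ x) \<longlonglongrightarrow> fst v' $ i $ x"
    and lim_p: "(\<lambda>k. fst (p k) $ i $ x) \<longlonglongrightarrow> fst p' $ i $ x" for i x
    by (intro tendsto_intros assms)+
  have "(\<lambda>k. snd (v k)) \<longlonglongrightarrow> snd v'"
    by (intro tendsto_intros assms)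
  then have "snd v' = -1"
    by (simp add: * LIMSEQ_const_iff)
  moreover have "fst p' $ i $ x \<le> \<rho> $ i $ x" for i x
    by (rule LIMSEQ_le_const2[OF lim_p]) (use * in auto)
  moreover have "0 \<le> fst v' $ i $ x" for i x
    by (rule LIMSEQ_le_const[OF lim_v]) (use * in auto)
  moreover have "fst v' $ i $ x * (\<rho> $ i $ x - fst p' $ i $ x) = 0" for i x
  proof -
    have "(\<lambda>k. fst (v k) $ i $ x * (\<rho> $ i $ x - fst (p k) $ i $ x))
        \<longlonglongrightarrow> fst v' $ i $ x * (\<rho> $ i $ x - fst p' $ i $ x)"
      by (intro tendsto_intros lim_v lim_p)
    then show ?thesis
      unfolding * by (simp add: LIMSEQ_const_iff)
  qed
  ultimately have "(fst v', snd v') \<in> subdifferential (funG \<rho>) (fst p', snd p')"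
    unfolding subdifferential_funG by blast
  then show ?thesis by simp
qed

section \<open>Convergence of the iteration\<close>

text \<open>Minus the source component of \<open>adjoint opA u\<close>.\<close>

definition label_sum :: "('a::real_vector ^ 'n) \<Rightarrow> 'a" where
  "label_sum u = (\<Sum>i\<in>UNIV. u $ i)"

text \<open>The combination of the flows that \<open>M\<close> controls for all admissible
  \<open>a1\<close> and \<open>a2\<close>; it vanishes exactly on the pairs
  \<open>(- opL s, s)\<close>.\<close>

definition add_source :: "(('w::finite, 'h::finite) img ^ 'n) \<times> ('w, 'h) img \<Rightarrow> ('w, 'h) img ^ 'n" where
  "add_source = (\<lambda>(p, s). p + opL s)"

lemma linear_label_sum: "linear label_sum"
  by (rule linearI) (auto simp: label_sum_def sum.distrib scaleR_sum_right)

lemma linear_add_source: "linear add_source"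
  by (rule linearI) (auto simp: add_source_def opL_def vec_eq_iff algebra_simps)

lemma fst_eq_add_source: "fst p = add_source p - opL (snd p)"
  by (simp add: add_source_def case_prod_unfold)

lemma linear_opL: "linear opL"
  by (rule linearI) (auto simp: opL_def vec_eq_iff)

text \<open>The label sums of \<open>add_source p\<close> and \<open>opA p\<close> differ by
  \<open>2 n\<close> times the source flow. This recovers the source flow from the label sum of
  \<open>u\<close>, from \<open>add_source p\<close> and from the shifted multiplier, whose bounds
  and limits are accessible.\<close>

lemma snd_eq_label_sums:
  fixes p :: "(('w::finite, 'h::finite) img ^ 'n) \<times> ('w, 'h) img"
  assumes "c > 0"
  shows "snd p = (1 / (2 * real CARD('n) * c)) *\<^sub>R
    (label_sum u + c *\<^sub>R label_sum (add_source p) - label_sum (u + c *\<^sub>R opA p))"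
proof -
  obtain p1 s where p: "p = (p1, s)" by fastforce
  have L: "label_sum (opL s :: ('w, 'h) img ^ 'n) = real CARD('n) *\<^sub>R s"
    by (simp add: label_sum_def opL_def sum_constant_scaleR del: sum_constant)
  have "label_sum u + c *\<^sub>R label_sum (add_source p) - label_sum (u + c *\<^sub>R opA p) =
      (c * real CARD('n)) *\<^sub>R s + (c * real CARD('n)) *\<^sub>R s"
    by (simp add: p add_source_def opA_def L linear_add[OF linear_label_sum] linear_diff[OF linear_label_sum]
        linear_scale[OF linear_label_sum] scaleR_add_right scaleR_diff_right)
  also have "\<dots> = (2 * real CARD('n) * c) *\<^sub>R s"
    unfolding scaleR_left_distrib[symmetric] by (rule arg_cong[where f = "\<lambda>a. a *\<^sub>R s"]) simp
  finally show ?thesis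
    using assms by (simp add: p)
qed

lemmas linear_tendsto = bounded_linear.tendsto[OF linear_conv_bounded_linear[THEN iffD1]]

lemma bounded_range_linear:
  fixes T :: "'a::euclidean_space \<Rightarrow> 'b::real_normed_vector"
  assumes "linear T" "bounded (range x)"
  shows "bounded (range (\<lambda>k. T (x k)))"
  using bounded_linear_image[OF assms(2) linear_conv_bounded_linear[THEN iffD1, OF assms(1)]]
  by (simp add: image_image)

lemma bounded_range_Suc: "bounded (range (\<lambda>k. x (Suc k))) \<Longrightarrow> bounded (range x)"
  for x :: "nat \<Rightarrow> 'a::real_normed_vector"
proof -
  assume "bounded (range (\<lambda>k. x (Suc k)))"
  moreover have "range x = insert (x 0) (range (\<lambda>k. x (Suc k)))"
    by (rule UNIV_nat_eq[THEN arg_cong[of _ _ "(`) x"], unfolded image_insert image_image])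
  ultimately show ?thesis by simp
qed

section \<open>One run of the iteration and its Lyapunov function\<close>

locale relaxed_admm_potts =
  fixes \<alpha> a1 a2 c :: real
    and \<rho> :: "('w::{finite,linorder}, 'h::{finite,linorder}) img ^ 'n"
    and r :: "nat \<Rightarrow> real"
    and z0 :: "(('w, 'h) vfield ^ 'n) \<times> ((('w, 'h) img ^ 'n) \<times> ('w, 'h) img) \<times> (('w, 'h) img ^ 'n)"
    and z :: "nat \<Rightarrow> (('w, 'h) vfield ^ 'n) \<times> ((('w, 'h) img ^ 'n) \<times> ('w, 'h) img) \<times> (('w, 'h) img ^ 'n)"
  assumes \<alpha>: "\<alpha> \<ge> 0" and a1: "a1 \<ge> 2" and a2: "a2 \<ge> 2 * real CARD('n)" and c: "c > 0"
    and r_mono: "incseq r" and r_pos: "0 < r k" and r_le: "r k \<le> 2"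
    and seq: "relaxed_admm_seq (\<lambda>q. (8 * c) *\<^sub>R q) (\<lambda>p. c *\<^sub>R opAt a1 a2 p) opA opB
      (funG \<rho>) (funH \<alpha>) c r z0 z"
begin

definition "q k = fst (z k)"
definition "p k = fst (snd (z k))"
definition "u k = snd (snd (z k))"
definition "\<sigma> k = u k + c *\<^sub>R opA (p k)"
text \<open>The current \<open>p\<close> is paired with the next \<open>q\<close>, as in the
  multiplier step.\<close>

definition "res k = opA (p k) + opB (q (Suc k))"
text \<open>Inside the locale \<open>N\<close> and \<open>M\<close> are not the preconditioners but
  their differences with \<open>c B^* B\<close> and \<open>c A^* A\<close>, whose seminorms measure
  the iterates.\<close>

definition "N v = (8 * c) *\<^sub>R v - c *\<^sub>R adjoint opB (opB v)" for v :: "('w, 'h) vfield ^ 'n"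
definition "M v = c *\<^sub>R opAt a1 a2 v - c *\<^sub>R adjoint opA (opA v)"
  for v :: "(('w, 'h) img ^ 'n) \<times> ('w, 'h) img"

lemma psd_N: "pos_semidef N"
  using pos_semidef_opB_residual[of c] c unfolding N_def[abs_def] by simp

lemma psd_M: "pos_semidef M"
  using pos_semidef_opAt_residual[OF a1 a2, of c] c unfolding M_def[abs_def] by simp

lemma N_nonneg: "0 \<le> N v \<bullet> v" and linear_N: "linear N"
  using psd_N by (auto simp: pos_semidef_def)

lemma M_nonneg: "0 \<le> M v \<bullet> v" and linear_M: "linear M"
  using psd_M by (auto simp: pos_semidef_def)

lemma add_source_bound: "c * (norm (add_source v))\<^sup>2 \<le> M v \<bullet> v"
proof -
  obtain v1 v2 where v: "v = (v1, v2)" by fastforce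
  have "M v \<bullet> v = c * ((opAt a1 a2 (v1, v2) - adjoint opA (opA (v1, v2))) \<bullet> (v1, v2))"
    by (simp add: M_def v inner_diff_left right_diff_distrib)
  also have "\<dots> \<ge> c * (norm (add_source v))\<^sup>2"
    unfolding opAt_residual_inner using c a1 a2 by (simp add: v add_source_def)
  finally show ?thesis .
qed

lemma step: "relaxed_admm_step (\<lambda>q. (8 * c) *\<^sub>R q) (\<lambda>p. c *\<^sub>R opAt a1 a2 p) opA opB
    (funG \<rho>) (funH \<alpha>) c (r k) (q k, p k, u k) (q (Suc k), p (Suc k), u (Suc k))"
  using seq by (simp add: relaxed_admm_seq_def q_def p_def u_def)

lemma u_step:
  "u (Suc k) = u k - c *\<^sub>R (opA (p (Suc k)) - (1 - r k) *\<^sub>R opA (p k) + r k *\<^sub>R opB (q (Suc k)))"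
  using step[of k] by (simp add: relaxed_admm_step_def)

lemma u_step': "u (Suc k) = u k - c *\<^sub>R (opA (p (Suc k) - p k)) - (c * r k) *\<^sub>R res k"
  by (simp add: u_step res_def linear_diff[OF linear_opA] algebra_simps)

lemma \<sigma>_step: "\<sigma> (Suc k) = \<sigma> k - (c * r k) *\<^sub>R res k"
  by (simp add: \<sigma>_def u_step' linear_diff[OF linear_opA] algebra_simps)

lemmas linear_simps =
  linear_diff[OF linear_opB] linear_diff[OF linear_opA] linear_diff[OF linear_opAt]
  linear_diff[OF adjoint_linear[OF linear_opB]] linear_diff[OF adjoint_linear[OF linear_opA]]
  linear_add[OF adjoint_linear[OF linear_opB]] linear_add[OF adjoint_linear[OF linear_opA]]
  linear_scale[OF adjoint_linear[OF linear_opB]] linear_scale[OF adjoint_linear[OF linear_opA]]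

text \<open>With the increment collected in \<open>N\<close>, the multiplier seen by the new
  \<open>q\<close> is \<open>u k - c *\<^sub>R res k\<close>.\<close>

lemma q_step:
  "adjoint opB (u k - c *\<^sub>R res k) + N (q k - q (Suc k)) \<in> subdifferential (funH \<alpha>) (q (Suc k))"
proof -
  have "adjoint opB (- (c *\<^sub>R opA (p k)) + u k) + ((8 * c) *\<^sub>R q k - c *\<^sub>R adjoint opB (opB (q k)))
      - (8 * c) *\<^sub>R q (Suc k) \<in> subdifferential (funH \<alpha>) (q (Suc k))"
    using step[of k] by (auto simp: relaxed_admm_step_def resolvent_def)
  moreover have "adjoint opB (u k - c *\<^sub>R res k) + N (q k - q (Suc k)) =
      adjoint opB (- (c *\<^sub>R opA (p k)) + u k) + ((8 * c) *\<^sub>R q k - c *\<^sub>R adjoint opB (opB (q k)))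
      - (8 * c) *\<^sub>R q (Suc k)"
    by (simp add: res_def N_def linear_simps algebra_simps)
  ultimately show ?thesis by simp
qed

text \<open>The update of \<open>u\<close> absorbs the terms in \<open>opA (p (Suc k))\<close>, so
  the multiplier appears at its new index.\<close>

lemma p_step:
  "adjoint opA (u (Suc k)) + M (p k - p (Suc k)) \<in> subdifferential (funG \<rho>) (p (Suc k))"
proof -
  let ?y = "adjoint opA (- ((c * r k) *\<^sub>R opB (q (Suc k))) + (c * (1 - r k)) *\<^sub>R opA (p k) + u k)
      + (c *\<^sub>R opAt a1 a2 (p k) - c *\<^sub>R adjoint opA (opA (p k)))"
  have "?y - c *\<^sub>R opAt a1 a2 (p (Suc k)) \<in> subdifferential (funG \<rho>) (p (Suc k))"
    using step[of k] by (auto simp: relaxed_admm_step_def resolvent_def)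
  moreover have "adjoint opA (u (Suc k)) + M (p k - p (Suc k)) = ?y - c *\<^sub>R opAt a1 a2 (p (Suc k))"
    by (simp add: u_step M_def linear_simps algebra_simps)
  ultimately show ?thesis by simp
qed

text \<open>The index of \<open>p\<close> lags by one, since the descent combines the inclusion for
  \<open>p (Suc k)\<close> with that for \<open>q (Suc (Suc k))\<close>.\<close>

definition lyapunov where
  "lyapunov qs ps us k = (norm (\<sigma> (Suc k) - (us + c *\<^sub>R opA ps)))\<^sup>2 / (c * r (Suc k)) +
    N (q (Suc k) - qs) \<bullet> (q (Suc k) - qs) + M (p k - ps) \<bullet> (p k - ps)"

lemma lyapunov_descent:
  assumes "kkt_point \<alpha> \<rho> qs ps us"
  shows "lyapunov qs ps us (Suc k)
      + N (q (Suc k) - q (Suc (Suc k))) \<bullet> (q (Suc k) - q (Suc (Suc k)))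
      + M (p k - p (Suc k)) \<bullet> (p k - p (Suc k)) \<le> lyapunov qs ps us k"
proof -
  let ?\<sigma>s = "us + c *\<^sub>R opA ps"
  have kkt: "opA ps + opB qs = 0" "adjoint opB us \<in> subdifferential (funH \<alpha>) qs"
    "adjoint opA us \<in> subdifferential (funG \<rho>) ps"
    using assms by (auto simp: kkt_point_def)
  have "(norm (\<sigma> (Suc (Suc k)) - ?\<sigma>s))\<^sup>2 / (c * r (Suc k))
      + N (q (Suc (Suc k)) - qs) \<bullet> (q (Suc (Suc k)) - qs)
      + M (p (Suc k) - ps) \<bullet> (p (Suc k) - ps)
      + N (q (Suc k) - q (Suc (Suc k))) \<bullet> (q (Suc k) - q (Suc (Suc k)))
      + M (p k - p (Suc k)) \<bullet> (p k - p (Suc k)) \<le> lyapunov qs ps us k"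
    unfolding lyapunov_def
  proof (rule relaxed_admm_descent[OF linear_opA linear_opB psd_N psd_M c r_pos r_le kkt(1) _ _ \<sigma>_def refl])
    show "0 \<le> (adjoint opB (u (Suc k) - c *\<^sub>R (opA (p (Suc k)) + opB (q (Suc (Suc k))))) +
        N (q (Suc k) - q (Suc (Suc k))) - adjoint opB us) \<bullet> (q (Suc (Suc k)) - qs)"
      using funH_monotone[OF \<alpha> q_step kkt(2), of "Suc k"] by (simp add: res_def)
    show "0 \<le> (adjoint opA (u (Suc k)) + M (p k - p (Suc k)) - adjoint opA us) \<bullet> (p (Suc k) - ps)"
      by (rule funG_monotone[OF p_step kkt(3)])
    show "\<sigma> (Suc (Suc k)) = \<sigma> (Suc k) - (c * r (Suc k)) *\<^sub>R (opA (p (Suc k)) + opB (q (Suc (Suc k))))"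
      by (simp add: \<sigma>_step[of "Suc k"] res_def)
  qed
  \<comment> \<open>Monotonicity of \<open>r\<close> enters here: the weight
    \<open>1 / (c * r k)\<close> must not grow with \<open>k\<close>.\<close>
  moreover have "(norm (\<sigma> (Suc (Suc k)) - ?\<sigma>s))\<^sup>2 / (c * r (Suc (Suc k)))
      \<le> (norm (\<sigma> (Suc (Suc k)) - ?\<sigma>s))\<^sup>2 / (c * r (Suc k))"
    using c r_pos incseq_SucD[OF r_mono, of "Suc k"] by (intro divide_left_mono mult_left_mono) auto
  ultimately show ?thesis
    by (simp add: lyapunov_def)
qed

text \<open>The bound on \<open>\<sigma>\<close> is uniform in \<open>k\<close> because
  \<open>r k \<le> 2\<close> keeps the weight at least \<open>1 / (2 * c)\<close>.\<close>

lemma lyapunov_bounds: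
  shows "(norm (\<sigma> (Suc k) - (us + c *\<^sub>R opA ps)))\<^sup>2 \<le> 2 * c * lyapunov qs ps us k"
    and "N (q (Suc k) - qs) \<bullet> (q (Suc k) - qs) \<le> lyapunov qs ps us k"
    and "c * (norm (add_source (p k - ps)))\<^sup>2 \<le> lyapunov qs ps us k"
    and "0 \<le> lyapunov qs ps us k"
proof -
  let ?s = "(norm (\<sigma> (Suc k) - (us + c *\<^sub>R opA ps)))\<^sup>2 / (c * r (Suc k))"
  have s: "0 \<le> ?s"
    using c r_pos[of "Suc k"] by simp
  have "(norm (\<sigma> (Suc k) - (us + c *\<^sub>R opA ps)))\<^sup>2 = c * (r (Suc k) * ?s)"
    using c r_pos[of "Suc k"] by simp
  also have "\<dots> \<le> c * (2 * ?s)"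
    using c r_le s by (intro mult_left_mono mult_right_mono) auto
  also have "\<dots> = 2 * c * ?s"
    by (simp only: ac_simps)
  also have "\<dots> \<le> 2 * c * lyapunov qs ps us k"
    unfolding lyapunov_def
    using c N_nonneg[of "q (Suc k) - qs"] M_nonneg[of "p k - ps"] by (intro mult_left_mono) auto
  finally show "(norm (\<sigma> (Suc k) - (us + c *\<^sub>R opA ps)))\<^sup>2 \<le> 2 * c * lyapunov qs ps us k" .
  show "N (q (Suc k) - qs) \<bullet> (q (Suc k) - qs) \<le> lyapunov qs ps us k"
    and "c * (norm (add_source (p k - ps)))\<^sup>2 \<le> lyapunov qs ps us k"
    and "0 \<le> lyapunov qs ps us k"
    using s N_nonneg[of "q (Suc k) - qs"] M_nonneg[of "p k - ps"] add_source_bound[of "p k - ps"]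
    by (auto simp: lyapunov_def)
qed

lemma decseq_lyapunov:
  assumes "kkt_point \<alpha> \<rho> qs ps us"
  shows "decseq (lyapunov qs ps us)"
proof (rule decseq_SucI)
  fix k
  show "lyapunov qs ps us (Suc k) \<le> lyapunov qs ps us k"
    using lyapunov_descent[OF assms, of k] N_nonneg[of "q (Suc k) - q (Suc (Suc k))"]
      M_nonneg[of "p k - p (Suc k)"] by linarith
qed

section \<open>Vanishing increments and bounded iterates\<close>

lemma p_step_components:
  "(u (Suc k) + fst (M (p k - p (Suc k))), - label_sum (u (Suc k)) + snd (M (p k - p (Suc k))))
    \<in> subdifferential (funG \<rho>) (fst (p (Suc k)), snd (p (Suc k)))"
  using p_step[of k] by (cases "M (p k - p (Suc k))") (simp add: adjoint_opA label_sum_def)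

text \<open>The source component of a subgradient of \<open>G\<close> is \<open>-1\<close>, so the
  label sum differs from one only by an increment seen through \<open>M\<close>.\<close>

lemma label_sum_u: "label_sum (u (Suc k)) = 1 + snd (M (p k - p (Suc k)))"
  using p_step_components[of k] unfolding subdifferential_funG
  by (simp add: algebra_simps eq_neg_iff_add_eq_0)

text \<open>The Lyapunov function converges, so its decrements, which dominate both quadratic
  increments, tend to zero. Injectivity of \<open>N\<close> then gives the increments of
  \<open>q\<close> themselves, whereas for \<open>p\<close> semi-definiteness yields two weaker
  statements.\<close>

lemma q_increment: "(\<lambda>k. q (Suc k) - q k) \<longlonglongrightarrow> 0"
  and M_increment: "(\<lambda>k. M (p k - p (Suc k))) \<longlonglongrightarrow> 0"
  and add_source_increment: "(\<lambda>k. add_source (p (Suc k) - p k)) \<longlonglongrightarrow> 0"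
proof -
  obtain qs ps us where kkt: "kkt_point \<alpha> \<rho> qs ps us"
    using kkt_point_exists[OF \<alpha>] by blast
  let ?\<Phi> = "lyapunov qs ps us"
  obtain L where L: "?\<Phi> \<longlonglongrightarrow> L"
    using decseq_convergent[OF decseq_lyapunov[OF kkt], of 0] lyapunov_bounds(4)[of qs ps us] by blast
  have gap: "(\<lambda>k. ?\<Phi> k - ?\<Phi> (Suc k)) \<longlonglongrightarrow> 0"
    using tendsto_diff[OF L LIMSEQ_Suc[OF L]] by simp
  let ?n = "\<lambda>k. N (q (Suc k) - q (Suc (Suc k))) \<bullet> (q (Suc k) - q (Suc (Suc k)))"
  let ?m = "\<lambda>k. M (p k - p (Suc k)) \<bullet> (p k - p (Suc k))"
  have le: "?n k \<le> ?\<Phi> k - ?\<Phi> (Suc k)" "?m k \<le> ?\<Phi> k - ?\<Phi> (Suc k)" for k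
    using lyapunov_descent[OF kkt, of k] N_nonneg[of "q (Suc k) - q (Suc (Suc k))"]
      M_nonneg[of "p k - p (Suc k)"] by linarith+
  have n: "?n \<longlonglongrightarrow> 0" and m: "?m \<longlonglongrightarrow> 0"
    by (rule real_tendsto_sandwich[OF _ _ tendsto_const gap]; use le N_nonneg M_nonneg in simp)+
  have "(\<lambda>k. q (Suc k) - q (Suc (Suc k))) \<longlonglongrightarrow> 0"
    by (rule linear_inj_tendsto_0[OF linear_N _ pos_semidef_tendsto_0[OF psd_N n]])
      (use inj_opB_residual[OF c] in \<open>simp add: N_def\<close>)
  from tendsto_minus[OF this] have "(\<lambda>k. q (Suc (Suc k)) - q (Suc k)) \<longlonglongrightarrow> 0"
    by simp
  then show "(\<lambda>k. q (Suc k) - q k) \<longlonglongrightarrow> 0"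
    by (rule LIMSEQ_imp_Suc)
  show "(\<lambda>k. M (p k - p (Suc k))) \<longlonglongrightarrow> 0"
    by (rule pos_semidef_tendsto_0[OF psd_M m])
  have "(\<lambda>k. (norm (add_source (p k - p (Suc k))))\<^sup>2) \<longlonglongrightarrow> 0"
    by (rule real_tendsto_sandwich[OF _ _ tendsto_const tendsto_mult_right_zero[OF m, of "1 / c"]])
      (use add_source_bound c in \<open>simp_all add: pos_le_divide_eq mult.commute\<close>)
  then have "(\<lambda>k. norm (add_source (p k - p (Suc k)))) \<longlonglongrightarrow> 0"
    using tendsto_real_sqrt by fastforce
  then have "(\<lambda>k. - add_source (p k - p (Suc k))) \<longlonglongrightarrow> - 0"
    by (rule tendsto_minus[OF tendsto_norm_zero_cancel])
  then show "(\<lambda>k. add_source (p (Suc k) - p k)) \<longlonglongrightarrow> 0"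
    by (simp add: linear_diff[OF linear_add_source])
qed

lemma label_sum_u_tendsto: "(\<lambda>k. label_sum (u k)) \<longlonglongrightarrow> 1"
proof (rule LIMSEQ_imp_Suc)
  have "(\<lambda>k. 1 + snd (M (p k - p (Suc k)))) \<longlonglongrightarrow> 1 + snd (0 :: (('w, 'h) img ^ 'n) \<times> ('w, 'h) img)"
    by (intro tendsto_intros M_increment)
  then show "(\<lambda>k. label_sum (u (Suc k))) \<longlonglongrightarrow> 1"
    by (simp add: label_sum_u)
qed

lemma bounded_\<sigma>: "bounded (range \<sigma>)"
  and bounded_add_source: "bounded (range (\<lambda>k. add_source (p k)))"
proof -
  obtain qs ps us where kkt: "kkt_point \<alpha> \<rho> qs ps us"
    using kkt_point_exists[OF \<alpha>] by blast
  let ?\<Phi> = "lyapunov qs ps us" and ?\<sigma>s = "us + c *\<^sub>R opA ps"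
  have le: "?\<Phi> k \<le> ?\<Phi> 0" for k
    using decseq_lyapunov[OF kkt] by (simp add: decseq_def)
  have "norm (\<sigma> (Suc k) - ?\<sigma>s) \<le> sqrt (2 * c * ?\<Phi> 0)" for k
    using c by (intro real_le_rsqrt order_trans[OF lyapunov_bounds(1)[of k us ps qs]] mult_left_mono le)
      simp_all
  then have "norm (\<sigma> (Suc k)) \<le> norm ?\<sigma>s + sqrt (2 * c * ?\<Phi> 0)" for k
    by (meson norm_triangle_sub add_left_mono order_trans)
  then show "bounded (range \<sigma>)"
    by (intro bounded_range_Suc[of \<sigma>]) (auto simp: bounded_iff)
  have "norm (add_source (p k - ps)) \<le> sqrt (?\<Phi> 0 / c)" for k
    using order_trans[OF lyapunov_bounds(3) le] c
    by (intro real_le_rsqrt) (simp add: pos_le_divide_eq mult.commute)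
  then have "norm (add_source (p k)) \<le> norm (add_source ps) + sqrt (?\<Phi> 0 / c)" for k
    unfolding linear_diff[OF linear_add_source] by (meson norm_triangle_sub add_left_mono order_trans)
  then show "bounded (range (\<lambda>k. add_source (p k)))"
    by (auto simp: bounded_iff)
qed

lemma snd_p_eq: "snd (p k) = (1 / (2 * real CARD('n) * c)) *\<^sub>R
    (label_sum (u k) + c *\<^sub>R label_sum (add_source (p k)) - label_sum (\<sigma> k))"
  using snd_eq_label_sums[OF c, of "p k" "u k"] by (simp add: \<sigma>_def)

lemma u_eq: "u k = \<sigma> k - c *\<^sub>R opA (fst (p k), snd (p k))"
  by (simp add: \<sigma>_def)

text \<open>The components are rebuilt one at a time: the source flow from label sums, the other
  flows from \<open>add_source\<close>, \<open>u\<close> from \<open>\<sigma>\<close>; after the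
  first step \<open>q\<close> lies in the dual ball.\<close>

lemma bounded_iterates:
  shows "bounded (range p)" and "bounded (range u)" and "bounded (range q)"
proof -
  have s: "bounded (range (\<lambda>k. snd (p k)))"
    unfolding snd_p_eq
    by (intro bounded_scaleR_comp bounded_minus_comp bounded_plus_comp
        bounded_range_linear[OF linear_label_sum] bounded_\<sigma> bounded_add_source
        convergent_imp_bounded[OF label_sum_u_tendsto])
  have f: "bounded (range (\<lambda>k. fst (p k)))"
    unfolding fst_eq_add_source
    by (intro bounded_minus_comp bounded_add_source bounded_range_linear[OF linear_opL] s)
  have "range p \<subseteq> range (\<lambda>k. fst (p k)) \<times> range (\<lambda>k. snd (p k))"
    by (rule image_subsetI) (simp add: mem_Times_iff)
  then show p: "bounded (range p)"
    by (rule bounded_subset[OF bounded_Times[OF f s]])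
  show "bounded (range u)"
    unfolding u_eq
    using bounded_range_linear[OF linear_opA p]
    by (intro bounded_minus_comp bounded_\<sigma> bounded_scaleR_comp) simp
  have "q (Suc k) \<in> dual_ball \<alpha>" for k
    using q_step[of k] by (simp add: subdifferential_funH[OF \<alpha>])
  then show "bounded (range q)"
    by (intro bounded_range_Suc[of q] bounded_subset[OF compact_imp_bounded[OF compact_dual_ball]]) auto
qed

text \<open>
  \<open>M\<close> does not control the direction \<open>(s, \<dots>, s, -s)\<close> when \<open>a1 = 2\<close> and \<open>a2 = 2 n\<close>;
  along it \<open>p\<close> is controlled by complementarity, as some multiplier is bounded away from zero
  at every pixel.
\<close>

lemma p_increment: "(\<lambda>k. p (Suc k) - p k) \<longlonglongrightarrow> 0"
proof -
  have comp: "(\<lambda>k. snd (p (Suc (Suc k))) $ x - snd (p (Suc k)) $ x) \<longlonglongrightarrow> 0" for x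
  proof (rule complementarity_increment_tendsto_0)
    \<comment> \<open>The full subgradient component rather than \<open>u\<close> alone: it is
      exactly nonnegative and complementary, and differs from \<open>u\<close> by a null
      sequence.\<close>
    let ?U = "\<lambda>i k. u (Suc k) $ i $ x + fst (M (p k - p (Suc k))) $ i $ x"
    let ?R = "\<lambda>i k. \<rho> $ i $ x - fst (p (Suc k)) $ i $ x"
    show "0 \<le> ?U i k" "0 \<le> ?R i k" "?U i k * ?R i k = 0" for i k
      using p_step_components[of k] unfolding subdifferential_funG by (auto simp del: mult_eq_0_iff)
    have lin: "linear (\<lambda>v :: ('w, 'h) img ^ 'n. v $ i $ x)" "linear (\<lambda>s :: ('w, 'h) img. s $ x)" for i
      by (auto intro!: linearI)
    have bu: "bounded (range (\<lambda>k. u (Suc k)))" and bp: "bounded (range (\<lambda>k. p (Suc k)))"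
      by (rule bounded_subset[OF bounded_iterates(2)], blast)
        (rule bounded_subset[OF bounded_iterates(1)], blast)
    have M1: "(\<lambda>k. fst (M (p k - p (Suc k))) $ i $ x) \<longlonglongrightarrow> 0" for i
    proof -
      have "(\<lambda>k. fst (M (p k - p (Suc k))) $ i $ x) \<longlonglongrightarrow> fst (0 :: (('w, 'h) img ^ 'n) \<times> ('w, 'h) img) $ i $ x"
        by (intro tendsto_intros M_increment)
      then show ?thesis by simp
    qed
    show "bounded (range (?U i))" for i
      by (intro bounded_plus_comp convergent_imp_bounded[OF M1] bounded_range_linear[OF lin(1) bu])
    have bs: "bounded (range (\<lambda>k. snd (p (Suc k)) $ x))"
      by (rule bounded_range_linear[OF lin(2) bounded_range_linear[OF linear_snd bp]])
    show "bounded (range (\<lambda>k. snd (p (Suc (Suc k))) $ x - snd (p (Suc k)) $ x))"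
      by (intro bounded_minus_comp bs bounded_subset[OF bs]) auto
    have "(\<lambda>k. label_sum (u (Suc k)) $ x + (\<Sum>i\<in>UNIV. fst (M (p k - p (Suc k))) $ i $ x))
        \<longlonglongrightarrow> (1 :: ('w, 'h) img) $ x + (\<Sum>i\<in>(UNIV :: 'n set). 0)"
      by (intro tendsto_intros M1 LIMSEQ_Suc[OF label_sum_u_tendsto])
    then show "(\<lambda>k. \<Sum>i\<in>UNIV. ?U i k) \<longlonglongrightarrow> 1"
      by (simp add: sum.distrib label_sum_def)
    \<comment> \<open>Each slack changes by the source increment minus the increment of
      \<open>add_source\<close>, and the latter tends to zero.\<close>
    have "(\<lambda>k. - (add_source (p (Suc (Suc k)) - p (Suc k)) $ i $ x))
        \<longlonglongrightarrow> - ((0 :: ('w, 'h) img ^ 'n) $ i $ x)" for i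
      by (intro tendsto_intros LIMSEQ_Suc[OF add_source_increment])
    then show "(\<lambda>k. ?R i (Suc k) - ?R i k - (snd (p (Suc (Suc k))) $ x - snd (p (Suc k)) $ x)) \<longlonglongrightarrow> 0" for i
      by (simp add: add_source_def opL_def case_prod_unfold algebra_simps)
  qed
  have "(\<lambda>k. snd (p (Suc k) - p k) $ x) \<longlonglongrightarrow> (0 :: ('w, 'h) img) $ x" for x
    by (rule LIMSEQ_imp_Suc) (use comp[of x] in simp)
  then have s: "(\<lambda>k. snd (p (Suc k) - p k)) \<longlonglongrightarrow> 0"
    by (rule vec_tendstoI)
  have "(\<lambda>k. add_source (p (Suc k) - p k) - opL (snd (p (Suc k) - p k))) \<longlonglongrightarrow> 0 - opL 0"
    by (intro tendsto_intros add_source_increment linear_tendsto[OF linear_opL] s)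
  then have "(\<lambda>k. fst (p (Suc k) - p k)) \<longlonglongrightarrow> 0"
    unfolding fst_eq_add_source[symmetric] by (simp add: linear_0[OF linear_opL])
  from tendsto_Pair[OF this s] show ?thesis
    unfolding prod.collapse zero_prod_def[symmetric] .
qed

text \<open>The increments of \<open>\<sigma>\<close> are \<open>- c * r k\<close> times the
  residual. They vary slowly because \<open>r\<close> converges and the residual varies slowly, so
  boundedness of \<open>\<sigma>\<close> makes them vanish; \<open>r\<close> has a positive limit,
  so one may divide by \<open>c * r k\<close>.\<close>

lemma res_tendsto: "res \<longlonglongrightarrow> 0"
proof -
  have "(\<lambda>k. opA (p (Suc k) - p k) + opB (q (Suc (Suc k)) - q (Suc k))) \<longlonglongrightarrow> opA 0 + opB 0"
    by (intro tendsto_intros linear_tendsto[OF linear_opA] linear_tendsto[OF linear_opB] p_increment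
        LIMSEQ_Suc[OF q_increment])
  then have res_inc: "(\<lambda>k. res (Suc k) - res k) \<longlonglongrightarrow> 0"
    by (simp add: res_def linear_diff[OF linear_opA] linear_diff[OF linear_opB] linear_0[OF linear_opA]
        linear_0[OF linear_opB] algebra_simps)
  obtain R where R: "r \<longlonglongrightarrow> R" and "\<forall>k. r k \<le> R"
    using incseq_convergent[OF r_mono, of 2] r_le by blast
  have "R \<noteq> 0"
    using \<open>\<forall>k. r k \<le> R\<close> r_pos by (metis not_less)
  have "range (\<lambda>k. q (Suc k)) \<subseteq> range q" by auto
  then have "bounded (range res)"
    unfolding res_def[abs_def]
    by (intro bounded_plus_comp bounded_range_linear[OF linear_opA] bounded_range_linear[OF linear_opB]
        bounded_iterates bounded_subset[OF bounded_iterates(3)])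
  then obtain C where C: "\<And>k. norm (res k) \<le> C"
    by (auto simp: bounded_iff)
  have "(\<lambda>k. r (Suc k) - r k) \<longlonglongrightarrow> 0"
    using tendsto_diff[OF LIMSEQ_Suc[OF R] R] by simp
  then have "(\<lambda>k. (r (Suc k) - r k) *\<^sub>R res k) \<longlonglongrightarrow> 0"
    by (rule lim_null_scaleR_bounded[where B = C]) (simp add: C)
  \<comment> \<open>Product rule: this is the change of \<open>- c * r k\<close> times the residual
    from one index to the next.\<close>
  then have "(\<lambda>k. (- c) *\<^sub>R (r (Suc k) *\<^sub>R (res (Suc k) - res k) + (r (Suc k) - r k) *\<^sub>R res k))
      \<longlonglongrightarrow> (- c) *\<^sub>R (R *\<^sub>R 0 + 0)"
    by (intro tendsto_intros res_inc LIMSEQ_Suc[OF R])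
  then have "(\<lambda>k. \<sigma> (Suc k) - \<sigma> k) \<longlonglongrightarrow> 0"
    by (intro increments_tendsto_0[OF bounded_\<sigma>]) (simp add: \<sigma>_step algebra_simps)
  then have "(\<lambda>k. (- 1 / (c * r k)) *\<^sub>R (\<sigma> (Suc k) - \<sigma> k)) \<longlonglongrightarrow> (- 1 / (c * R)) *\<^sub>R 0"
    using c \<open>R \<noteq> 0\<close> by (intro tendsto_intros R) auto
  moreover have "(- 1 / (c * r k)) *\<^sub>R (\<sigma> (Suc k) - \<sigma> k) = res k" for k
    using c r_pos[of k] by (simp add: \<sigma>_step)
  ultimately show ?thesis by simp
qed

lemma u_increment: "(\<lambda>k. u (Suc k) - u k) \<longlonglongrightarrow> 0"
proof -
  have "(\<lambda>k. r k *\<^sub>R res k) \<longlonglongrightarrow> 0"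
  proof (rule Lim_null_comparison)
    show "\<forall>\<^sub>F k in sequentially. norm (r k *\<^sub>R res k) \<le> 2 * norm (res k)"
      using r_pos r_le by (simp add: mult_right_mono less_imp_le)
    show "(\<lambda>k. 2 * norm (res k)) \<longlonglongrightarrow> 0"
      by (intro tendsto_mult_right_zero tendsto_norm_zero res_tendsto)
  qed
  then have "(\<lambda>k. - (c *\<^sub>R opA (p (Suc k) - p k)) - c *\<^sub>R (r k *\<^sub>R res k)) \<longlonglongrightarrow> - (c *\<^sub>R opA 0) - c *\<^sub>R 0"
    by (intro tendsto_intros linear_tendsto[OF linear_opA] p_increment)
  then show ?thesis
    by (simp add: u_step' linear_0[OF linear_opA])
qed

text \<open>As all increments vanish, the shifted subsequences have the same limits, and both
  inclusions pass to the limit by the closed graphs.\<close>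

lemma cluster_point_kkt:
  assumes f: "strict_mono f" and lim: "(z \<circ> f) \<longlonglongrightarrow> (qs, ps, us)"
  shows "kkt_point \<alpha> \<rho> qs ps us"
proof -
  have qf: "(\<lambda>k. q (f k)) \<longlonglongrightarrow> qs" and pf: "(\<lambda>k. p (f k)) \<longlonglongrightarrow> ps" and uf: "(\<lambda>k. u (f k)) \<longlonglongrightarrow> us"
    using tendsto_fst[OF lim] tendsto_fst[OF tendsto_snd[OF lim]] tendsto_snd[OF tendsto_snd[OF lim]]
    by (simp_all add: q_def p_def u_def o_def)
  have q': "(\<lambda>k. q (Suc (f k))) \<longlonglongrightarrow> qs"
    using tendsto_add[OF LIMSEQ_subseq_LIMSEQ[OF q_increment f] qf] by (simp add: o_def)
  have p': "(\<lambda>k. p (Suc (f k))) \<longlonglongrightarrow> ps"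
    using tendsto_add[OF LIMSEQ_subseq_LIMSEQ[OF p_increment f] pf] by (simp add: o_def)
  have u': "(\<lambda>k. u (Suc (f k))) \<longlonglongrightarrow> us"
    using tendsto_add[OF LIMSEQ_subseq_LIMSEQ[OF u_increment f] uf] by (simp add: o_def)
  have resf: "(\<lambda>k. res (f k)) \<longlonglongrightarrow> 0"
    using LIMSEQ_subseq_LIMSEQ[OF res_tendsto f] by (simp add: o_def)
  have "(\<lambda>k. res (f k)) \<longlonglongrightarrow> opA ps + opB qs"
    unfolding res_def
    by (intro tendsto_intros linear_tendsto[OF linear_opA] linear_tendsto[OF linear_opB] pf q')
  with resf have "opA ps + opB qs = 0"
    by (metis LIMSEQ_unique)
  moreover have "adjoint opB us \<in> subdifferential (funH \<alpha>) qs"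
  proof (rule subdifferential_funH_closed[OF \<alpha> q_step _ q'])
    have "(\<lambda>k. adjoint opB (u (f k) - c *\<^sub>R res (f k)) + N (q (f k) - q (Suc (f k))))
        \<longlonglongrightarrow> adjoint opB (us - c *\<^sub>R 0) + N (qs - qs)"
      by (intro tendsto_intros linear_tendsto[OF adjoint_linear[OF linear_opB]] linear_tendsto[OF linear_N]
          uf resf qf q')
    then show "(\<lambda>k. adjoint opB (u (f k) - c *\<^sub>R res (f k)) + N (q (f k) - q (Suc (f k)))) \<longlonglongrightarrow> adjoint opB us"
      by (simp add: linear_0[OF linear_N])
  qed
  moreover have "adjoint opA us \<in> subdifferential (funG \<rho>) ps"
  proof (rule subdifferential_funG_closed[OF p_step _ p'])
    have "(\<lambda>k. adjoint opA (u (Suc (f k))) + M (p (f k) - p (Suc (f k))))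
        \<longlonglongrightarrow> adjoint opA us + M (ps - ps)"
      by (intro tendsto_intros linear_tendsto[OF adjoint_linear[OF linear_opA]] linear_tendsto[OF linear_M]
          u' pf p')
    then show "(\<lambda>k. adjoint opA (u (Suc (f k))) + M (p (f k) - p (Suc (f k)))) \<longlonglongrightarrow> adjoint opA us"
      by (simp add: linear_0[OF linear_M])
  qed
  ultimately show ?thesis
    by (simp add: kkt_point_def)
qed

text \<open>A cluster point is a KKT point and can therefore serve as the reference of the Lyapunov
  function, which tends to zero along the subsequence and, being monotone, along the whole
  sequence.\<close>

theorem converges_to_kkt_point:
  obtains qs ps us where "kkt_point \<alpha> \<rho> qs ps us" "z \<longlonglongrightarrow> (qs, ps, us)"
proof -
  have "range z \<subseteq> range q \<times> range p \<times> range u"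
    by (intro image_subsetI) (simp add: q_def p_def u_def mem_Times_iff)
  then have "bounded (range z)"
    by (rule bounded_subset[OF bounded_Times[OF bounded_iterates(3) bounded_Times[OF bounded_iterates(1,2)]]])
  then obtain l f where f: "strict_mono f" and lim: "(z \<circ> f) \<longlonglongrightarrow> l"
    using bounded_imp_convergent_subsequence by blast
  obtain qs ps us where l: "l = (qs, ps, us)"
    by (cases l) auto
  have kkt: "kkt_point \<alpha> \<rho> qs ps us"
    using cluster_point_kkt[OF f] lim unfolding l .
  let ?\<Phi> = "lyapunov qs ps us" and ?\<sigma>s = "us + c *\<^sub>R opA ps"
  have qf: "(\<lambda>k. q (f k)) \<longlonglongrightarrow> qs" and pf: "(\<lambda>k. p (f k)) \<longlonglongrightarrow> ps" and uf: "(\<lambda>k. u (f k)) \<longlonglongrightarrow> us"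
    using tendsto_fst[OF lim[unfolded l]] tendsto_fst[OF tendsto_snd[OF lim[unfolded l]]]
      tendsto_snd[OF tendsto_snd[OF lim[unfolded l]]]
    by (simp_all add: q_def p_def u_def o_def)
  have q': "(\<lambda>k. q (Suc (f k))) \<longlonglongrightarrow> qs"
    using tendsto_add[OF LIMSEQ_subseq_LIMSEQ[OF q_increment f] qf] by (simp add: o_def)
  have p': "(\<lambda>k. p (Suc (f k))) \<longlonglongrightarrow> ps"
    using tendsto_add[OF LIMSEQ_subseq_LIMSEQ[OF p_increment f] pf] by (simp add: o_def)
  have u': "(\<lambda>k. u (Suc (f k))) \<longlonglongrightarrow> us"
    using tendsto_add[OF LIMSEQ_subseq_LIMSEQ[OF u_increment f] uf] by (simp add: o_def)
  obtain R where R: "r \<longlonglongrightarrow> R" and "\<forall>k. r k \<le> R"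
    using incseq_convergent[OF r_mono, of 2] r_le by blast
  have "R \<noteq> 0"
    using \<open>\<forall>k. r k \<le> R\<close> r_pos by (metis not_less)
  obtain L where L: "?\<Phi> \<longlonglongrightarrow> L"
    using decseq_convergent[OF decseq_lyapunov[OF kkt], of 0] lyapunov_bounds(4)[of qs ps us] by blast
  have "(\<lambda>k. r (Suc (f k))) \<longlonglongrightarrow> R"
    using LIMSEQ_subseq_LIMSEQ[OF LIMSEQ_Suc[OF R] f] by (simp add: o_def)
  then have "(\<lambda>k. ?\<Phi> (f k)) \<longlonglongrightarrow> (norm (us + c *\<^sub>R opA ps - ?\<sigma>s))\<^sup>2 / (c * R) +
      N (qs - qs) \<bullet> (qs - qs) + M (ps - ps) \<bullet> (ps - ps)"
    unfolding lyapunov_def \<sigma>_def using c \<open>R \<noteq> 0\<close>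
    by (intro tendsto_intros linear_tendsto[OF linear_opA] linear_tendsto[OF linear_N]
        linear_tendsto[OF linear_M] q' p' u' pf) auto
  moreover have "(\<lambda>k. ?\<Phi> (f k)) \<longlonglongrightarrow> L"
    using LIMSEQ_subseq_LIMSEQ[OF L f] by (simp add: o_def)
  ultimately have "L = 0"
    using LIMSEQ_unique by fastforce
  with L have \<Phi>: "?\<Phi> \<longlonglongrightarrow> 0" by simp
  have norm_0: "x \<longlonglongrightarrow> 0" if "\<And>k. (norm (x k))\<^sup>2 \<le> K * ?\<Phi> k"
    for x :: "nat \<Rightarrow> ('w, 'h) img ^ 'n" and K
  proof -
    have "(\<lambda>k. (norm (x k))\<^sup>2) \<longlonglongrightarrow> 0"
      by (rule real_tendsto_sandwich[OF _ _ tendsto_const tendsto_mult_right_zero[OF \<Phi>, of K]])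
        (use that in auto)
    then have "(\<lambda>k. norm (x k)) \<longlonglongrightarrow> 0"
      using tendsto_real_sqrt by fastforce
    then show ?thesis by (rule tendsto_norm_zero_cancel)
  qed
  have "(\<lambda>k. \<sigma> (Suc k) - ?\<sigma>s) \<longlonglongrightarrow> 0"
    by (rule norm_0[OF lyapunov_bounds(1)])
  then have \<sigma>: "\<sigma> \<longlonglongrightarrow> ?\<sigma>s"
    by (intro LIMSEQ_imp_Suc[of \<sigma>]) (simp add: LIM_zero_iff)
  have "(\<lambda>k. add_source (p k - ps)) \<longlonglongrightarrow> 0"
    by (rule norm_0[of _ "1 / c"]) (use lyapunov_bounds(3) c in \<open>simp add: pos_le_divide_eq mult.commute\<close>)
  then have \<tau>: "(\<lambda>k. add_source (p k)) \<longlonglongrightarrow> add_source ps"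
    by (simp add: linear_diff[OF linear_add_source] LIM_zero_iff)
  have "(\<lambda>k. N (q (Suc k) - qs) \<bullet> (q (Suc k) - qs)) \<longlonglongrightarrow> 0"
    by (rule real_tendsto_sandwich[OF _ _ tendsto_const \<Phi>]) (use lyapunov_bounds(2) N_nonneg in auto)
  then have "(\<lambda>k. q (Suc k) - qs) \<longlonglongrightarrow> 0"
    by (intro linear_inj_tendsto_0[OF linear_N _ pos_semidef_tendsto_0[OF psd_N]])
      (use inj_opB_residual[OF c] in \<open>simp_all add: N_def\<close>)
  then have q: "q \<longlonglongrightarrow> qs"
    by (intro LIMSEQ_imp_Suc[of q]) (simp add: LIM_zero_iff)
  \<comment> \<open>The Lyapunov function may leave the direction \<open>(- opL s, s)\<close>
    undetermined. The label sums of \<open>u\<close>, convergent along the whole sequence, fix the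
    source flow instead.\<close>
  have "(\<lambda>k. label_sum (u (f k))) \<longlonglongrightarrow> label_sum us"
    by (intro linear_tendsto[OF linear_label_sum] uf)
  moreover have "(\<lambda>k. label_sum (u (f k))) \<longlonglongrightarrow> 1"
    using LIMSEQ_subseq_LIMSEQ[OF label_sum_u_tendsto f] by (simp add: o_def)
  ultimately have "label_sum us = 1"
    by (rule LIMSEQ_unique)
  then have U: "(\<lambda>k. label_sum (u k)) \<longlonglongrightarrow> label_sum us"
    using label_sum_u_tendsto by simp
  have s: "(\<lambda>k. snd (p k)) \<longlonglongrightarrow> snd ps"
    unfolding snd_p_eq snd_eq_label_sums[OF c, of ps us]
    by (intro tendsto_intros linear_tendsto[OF linear_label_sum] U \<sigma> \<tau>)
  have "(\<lambda>k. fst (p k)) \<longlonglongrightarrow> fst ps"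
    unfolding fst_eq_add_source by (intro tendsto_intros linear_tendsto[OF linear_opL] s \<tau>)
  from tendsto_Pair[OF this s] have p: "p \<longlonglongrightarrow> ps" by simp
  have "(\<lambda>k. \<sigma> k - c *\<^sub>R opA (p k)) \<longlonglongrightarrow> ?\<sigma>s - c *\<^sub>R opA ps"
    by (intro tendsto_intros linear_tendsto[OF linear_opA] \<sigma> p)
  then have "u \<longlonglongrightarrow> us"
    by (simp add: \<sigma>_def)
  from tendsto_Pair[OF q tendsto_Pair[OF p this]] have "z \<longlonglongrightarrow> (qs, ps, us)"
    by (simp add: q_def p_def u_def)
  with kkt that show thesis by blast
qed

end

section \<open>Semi-definiteness, well-posedness and weak convergence together\<close>

theorem theorem3:
  fixes \<alpha> a1 a2 :: real
    and \<rho> :: "('w::{finite,linorder}, 'h::{finite,linorder}) img ^ 'n"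
  assumes "\<alpha> > 0" and "a1 \<ge> 2" and "a2 \<ge> 2 * real CARD('n)"
  shows "pos_semidef (\<lambda>p :: (('w, 'h) img ^ 'n) \<times> ('w, 'h) img.
      opAt a1 a2 p - adjoint opA (opA p)) \<and>
    (\<forall>c>0. \<forall>N M.
      N = (\<lambda>q :: ('w, 'h) vfield ^ 'n. (8 * c) *\<^sub>R q) \<and>
      M = (\<lambda>p :: (('w, 'h) img ^ 'n) \<times> ('w, 'h) img. c *\<^sub>R opAt a1 a2 p) \<longrightarrow>
      pos_semidef (\<lambda>q. N q - c *\<^sub>R adjoint opB (opB q)) \<and>
      pos_semidef (\<lambda>p. M p - c *\<^sub>R adjoint opA (opA p)) \<and>
      (\<forall>r :: nat \<Rightarrow> real. incseq r \<and> (\<forall>k. 0 < r k \<and> r k < 2) \<longrightarrow>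
        (\<forall>z0.
          (\<exists>!z. relaxed_admm_seq N M opA opB (funG \<rho>) (funH \<alpha>) c r z0 z) \<and>
          (\<forall>z. relaxed_admm_seq N M opA opB (funG \<rho>) (funH \<alpha>) c r z0 z \<longrightarrow>
            (\<exists>qs ps us.
              weakly_converges_to z (qs, ps, us) \<and>
              saddle_point (aug_lagrangian opA opB (funG \<rho>) (funH \<alpha>) c) qs ps us \<and>
              maxflow_solution \<alpha> \<rho> qs ps)))))"
proof (intro conjI allI impI; (elim conjE, hypsubst)?)
  show "pos_semidef (\<lambda>p :: (('w, 'h) img ^ 'n) \<times> ('w, 'h) img. opAt a1 a2 p - adjoint opA (opA p))"
    using pos_semidef_opAt_residual[OF assms(2,3), of 1] by simp
next
  fix c :: real assume "c > 0"
  then show "pos_semidef (\<lambda>q :: ('w, 'h) vfield ^ 'n. (8 * c) *\<^sub>R q - c *\<^sub>R adjoint opB (opB q))"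
    by (intro pos_semidef_opB_residual) simp
  from \<open>c > 0\<close> show "pos_semidef (\<lambda>p :: (('w, 'h) img ^ 'n) \<times> ('w, 'h) img.
      c *\<^sub>R opAt a1 a2 p - c *\<^sub>R adjoint opA (opA p))"
    by (intro pos_semidef_opAt_residual assms) simp
next
  fix c :: real and r z0
  assume "c > 0"
  have "a1 > 0" "a2 > 0"
    using assms by (auto intro: less_le_trans[of 0 "2 * real CARD('n)"])
  with \<open>c > 0\<close> assms show "\<exists>!z. relaxed_admm_seq (\<lambda>q :: ('w, 'h) vfield ^ 'n. (8 * c) *\<^sub>R q)
      (\<lambda>p. c *\<^sub>R opAt a1 a2 p) opA opB (funG \<rho>) (funH \<alpha>) c r z0 z"
    by (intro relaxed_admm_seq_ex1) auto
next
  fix c :: real and r z0 z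
  assume "c > 0" "incseq r" "\<forall>k. 0 < r k \<and> r k < 2"
    and seq: "relaxed_admm_seq (\<lambda>q :: ('w, 'h) vfield ^ 'n. (8 * c) *\<^sub>R q)
      (\<lambda>p. c *\<^sub>R opAt a1 a2 p) opA opB (funG \<rho>) (funH \<alpha>) c r z0 z"
  then interpret relaxed_admm_potts \<alpha> a1 a2 c \<rho> r z0 z
    using assms by unfold_locales (auto simp: less_imp_le)
  obtain qs ps us where kkt: "kkt_point \<alpha> \<rho> qs ps us" and lim: "z \<longlonglongrightarrow> (qs, ps, us)"
    by (rule converges_to_kkt_point)
  \<comment> \<open>The iterates converge in norm, and bounded functionals preserve this.\<close>
  have "weakly_converges_to z (qs, ps, us)"
    unfolding weakly_converges_to_def by (intro allI impI bounded_linear.tendsto[OF _ lim])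
  moreover have "saddle_point (aug_lagrangian opA opB (funG \<rho>) (funH \<alpha>) c) qs ps us"
    using kkt_point_imp_saddle_point[OF kkt] assms \<open>c > 0\<close> by simp
  moreover have "maxflow_solution \<alpha> \<rho> qs ps"
    using kkt_point_imp_maxflow_solution[OF kkt] assms by simp
  ultimately show "\<exists>qs ps us. weakly_converges_to z (qs, ps, us) \<and>
      saddle_point (aug_lagrangian opA opB (funG \<rho>) (funH \<alpha>) c) qs ps us \<and> maxflow_solution \<alpha> \<rho> qs ps"
    by blast
qed

end
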